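(* Let $0\le\alpha<\frac{\pi}{2}$, let $A\in\mathcal{S}_\alpha$ be an accretive $n\times n$ complex matrix, and let $f:(0,\infty)\to(0,\infty)$ be an operator monotone function with $f(1)=1$. Then $$\cos\alpha\;f(w(A))\le w(f(A))\le\sec^3\alpha\;f(w(A)).$$
   Context: $\mathcal{M}_n$ is the algebra of complex $n\times n$ matrices. For $A\in\mathcal{M}_n$: $w(A)=\max\{|\langle Ax,x\rangle|:x\in\mathbb{C}^n,\|x\|=1\}$ is the numerical radius and $W(A)=\{\langle Ax,x\rangle:x\in\mathbb{C}^n,\|x\|=1\}$ is the numerical range. $A$ is accretive if $\Re A=\frac{A+A^*}{2}$ is positive definite. For $0\le\alpha<\pi/2$ let $S_\alpha=\{z\in\mathbb{C}:|\Im z|\le\tan\alpha\,\Re z\}$; we write $A\in\mathcal{S}_\alpha$ if $W(A)\subset S_\alpha$. A function $f:(0,\infty)\to(0,\infty)$ is operator monotone if $X\le Y$ implies $f(X)\le f(Y)$ for all positive definite matrices $X,Y$ of any size. If moreover $f(1)=1$, there is a probability measure $\nu_f$ on $[0,1]$ with $f(x)=\int_0^1((1-s)+sx^{-1})^{-1}d\nu_f(s)$ for $x>0$, and for accretive $A$ one defines $f(A)=\int_0^1((1-s)I+sA^{-1})^{-1}d\nu_f(s)$. *)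

theory Defs
  imports
    "HOL-Probability.Probability"
    "Jordan_Normal_Form.Gauss_Jordan_Elimination"
    "Jordan_Normal_Form.Schur_Decomposition"
begin

(* Square complex matrices are elements of carrier_mat n n, so that the size n can be
   quantified over inside a formula.  The inner product <x, y> is  x \<bullet>c y  (linear in x,
   conjugate-linear in y). *)

definition numerical_range :: "complex mat \<Rightarrow> complex set" where
  "numerical_range A =
     {(A *\<^sub>v x) \<bullet>c x | x. x \<in> carrier_vec (dim_row A) \<and> x \<bullet>c x = 1}"

(* For sizes n > 0 the unit sphere is compact and nonempty, so this supremum is a maximum. *)
definition numerical_radius :: "complex mat \<Rightarrow> real" where
  "numerical_radius A = Sup (cmod ` numerical_range A)"

definition hermitian_mat :: "complex mat \<Rightarrow> bool" where
  "hermitian_mat X \<longleftrightarrow> mat_adjoint X = X"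

(* For a Hermitian matrix the quadratic form is real, so taking Re loses nothing. *)
definition pos_semidef :: "complex mat \<Rightarrow> bool" where
  "pos_semidef X \<longleftrightarrow>
     hermitian_mat X \<and> (\<forall>x \<in> carrier_vec (dim_row X). 0 \<le> Re ((X *\<^sub>v x) \<bullet>c x))"

definition pos_def :: "complex mat \<Rightarrow> bool" where
  "pos_def X \<longleftrightarrow>
     hermitian_mat X \<and>
     (\<forall>x \<in> carrier_vec (dim_row X). x \<noteq> 0\<^sub>v (dim_row X) \<longrightarrow> 0 < Re ((X *\<^sub>v x) \<bullet>c x))"

definition real_part_mat :: "complex mat \<Rightarrow> complex mat" where
  "real_part_mat A = (1 / 2) \<cdot>\<^sub>m (A + mat_adjoint A)"

definition accretive :: "complex mat \<Rightarrow> bool" where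
  "accretive A \<longleftrightarrow> pos_def (real_part_mat A)"

definition sector :: "real \<Rightarrow> complex set" where
  "sector \<alpha> = {z. \<bar>Im z\<bar> \<le> tan \<alpha> * Re z}"

definition sectorial :: "real \<Rightarrow> complex mat \<Rightarrow> bool" where
  "sectorial \<alpha> A \<longleftrightarrow> numerical_range A \<subseteq> sector \<alpha>"

(* Functional calculus for Hermitian X = U diag(d) U*, U unitary:  f(X) = U diag(f o d) U*.
   The result does not depend on the chosen decomposition. *)
definition hermitian_fun :: "(real \<Rightarrow> real) \<Rightarrow> complex mat \<Rightarrow> complex mat" where
  "hermitian_fun f X = (SOME B. \<exists>U (d :: nat \<Rightarrow> real).
     U \<in> carrier_mat (dim_row X) (dim_row X) \<and>
     U * mat_adjoint U = 1\<^sub>m (dim_row X) \<and>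
     X = U * mat_diag (dim_row X) (\<lambda>i. complex_of_real (d i)) * mat_adjoint U \<and>
     B = U * mat_diag (dim_row X) (\<lambda>i. complex_of_real (f (d i))) * mat_adjoint U)"

(* A function on (0, oo) is a total function whose values outside (0, oo) are irrelevant;
   only eigenvalues of positive definite matrices are fed to f here. *)
definition operator_monotone :: "(real \<Rightarrow> real) \<Rightarrow> bool" where
  "operator_monotone f \<longleftrightarrow>
     (\<forall>n. \<forall>X \<in> carrier_mat n n. \<forall>Y \<in> carrier_mat n n.
        pos_def X \<longrightarrow> pos_def Y \<longrightarrow> pos_semidef (Y - X) \<longrightarrow>
        pos_semidef (hermitian_fun f Y - hermitian_fun f X))"

(* nu is a Borel probability measure on [0,1] representing f. *)
definition represents :: "real measure \<Rightarrow> (real \<Rightarrow> real) \<Rightarrow> bool" where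
  "represents \<nu> f \<longleftrightarrow>
     prob_space \<nu> \<and> sets \<nu> = sets (restrict_space borel {0..1}) \<and>
     (\<forall>x>0. f x = (\<integral>s. inverse ((1 - s) + s * inverse x) \<partial>\<nu>))"

(* nu_f: it exists and is unique for operator monotone f > 0 with f(1) = 1 (Loewner's theorem). *)
definition rep_measure :: "(real \<Rightarrow> real) \<Rightarrow> real measure" where
  "rep_measure f = (SOME \<nu>. represents \<nu> f)"

(* Used on invertible matrices only; there mat_inverse returns Some inverse. *)
definition inv_mat :: "complex mat \<Rightarrow> complex mat" where
  "inv_mat A = the (mat_inverse A)"

(* The matrix-valued integral is taken entrywise. *)
definition accretive_fun :: "(real \<Rightarrow> real) \<Rightarrow> complex mat \<Rightarrow> complex mat" where
  "accretive_fun f A = Matrix.mat (dim_row A) (dim_row A) (\<lambda>(i, j).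
     \<integral>s. inv_mat (complex_of_real (1 - s) \<cdot>\<^sub>m 1\<^sub>m (dim_row A)
                  + complex_of_real s \<cdot>\<^sub>m inv_mat A) $$ (i, j) \<partial>rep_measure f)"

end

theory Submission
  imports Defs
begin

text \<open>
  The measure \<open>\<nu>\<^sub>f\<close> exists by Loewner's theorem.  A rank-one perturbation of Hermitian matrices
  whose eigenvalues interlace the given nodes turns operator monotonicity into
  \<open>[x\<^sub>1, \<dots>, x\<^sub>2\<^sub>n] (f p\<^sup>2) \<ge> 0\<close> for \<open>deg p < n\<close>; moving two nodes to \<open>0\<close> and \<open>\<infinity>\<close> gives the same for
  \<open>- f(x) / x\<close>.  Since a polynomial that is nonnegative on \<open>[0, \<infinity>)\<close> is a sum of terms \<open>a\<^sup>2\<close> and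
  \<open>X b\<^sup>2\<close>, every finite linear combination of kernel values that is nonnegative for all parameters
  is nonnegative on \<open>f\<close>.  By duality \<open>f\<close> is approximated at finitely many points by
  mixtures of kernels, and Helly's selection theorem provides the measure.

  For the numerical radius, let \<open>r\<close> be the largest eigenvalue of \<open>\<Re> A\<close>, so that
  \<open>r \<le> w(A) \<le> sec \<alpha> r\<close>.  With \<open>x = (1 - s) A z + s z\<close> one has
  \<open>\<langle>((1 - s) I + s A\<^sup>-\<^sup>1)\<^sup>-\<^sup>1 x, x\<rangle> = \<langle>A z, x\<rangle>\<close>, whose real part is at most \<open>sec\<^sup>2 \<alpha>\<close> times the
  kernel at \<open>r\<close> (because \<open>\<parallel>A z\<parallel>\<^sup>2 \<le> sec\<^sup>2 \<alpha> r \<Re> \<langle>A z, z\<rangle>\<close>), and at least that kernel when \<open>x\<close> is a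
  unit eigenvector of \<open>\<Re> A\<close> for \<open>r\<close>.  Integrate, and use \<open>f(c x) \<le> c f(x)\<close> for \<open>c \<ge> 1\<close>.
\<close>

text \<open>\<open>rep_measure\<close> is a choice, so nothing can be said about
  \<open>accretive_fun f A\<close> before some representing measure is known to exist; hence the
  long detour through Loewner's theorem. No continuity or smoothness of \<open>f\<close> is given,
  so the argument works at finitely many nodes, and all other points are reached at the very end
  through monotonicity and scaling. Clearing denominators in a nonnegative combination of the
  functions \<open>x / (x + t)\<close> leaves a polynomial in \<open>t\<close> that is nonnegative
  on the half-line; its two kinds of summands call for exactly the two divided-difference
  inequalities. Of the three factors sec \<alpha>, two come from the Cauchy-Schwarz inequality for a
  sectorial form that is not Hermitian, and one from passing from the real part to the modulus,
  which is possible because the sector is stable under integration. The factor cos \<alpha> is the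
  price of replacing w(A) by r inside f.\<close>

unbundle no vec_syntax

section \<open>Lagrange interpolation\<close>

text \<open>For \<open>x\<close> in \<open>S\<close> this is the derivative at \<open>x\<close> of
  the monic polynomial with root set \<open>S\<close>, so the sum of
  \<open>g x / node_prod S x\<close> over \<open>S\<close> is the divided difference of
  \<open>g\<close>.\<close>

definition node_prod :: "'a::comm_ring_1 set \<Rightarrow> 'a \<Rightarrow> 'a" where
  "node_prod S x = (\<Prod>y\<in>S - {x}. x - y)"

lemma node_prod_nonzero:
  fixes x :: "'a::idom"
  assumes "finite S"
  shows "node_prod S x \<noteq> 0"
  using assms by (auto simp: node_prod_def)

lemma lagrange_interpolation:
  fixes q :: "'a::field poly"
  assumes "finite S" "degree q < card S"
  shows "q = (\<Sum>x\<in>S. Polynomial.smult (poly q x / node_prod S x) (\<Prod>y\<in>S - {x}. [:- y, 1:]))"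
    (is "q = ?L")
proof (rule poly_eqI_degree[where A = S])
  have degp: "degree (\<Prod>y\<in>S - {x}. [:- y, 1:]) = card S - 1" if "x \<in> S" for x
    using that assms by (subst degree_prod_eq_sum_degree) auto
  have "degree ?L \<le> card S - 1"
    by (intro degree_sum_le assms(1)) (use degp degree_smult_le le_trans in fastforce)
  then show "card S > degree ?L" using assms by linarith
next
  fix z assume z: "z \<in> S"
  have "poly ?L z = (\<Sum>x\<in>S. if x = z then poly q z else 0)"
    unfolding poly_sum
  proof (intro sum.cong refl)
    fix x assume x: "x \<in> S"
    show "poly (Polynomial.smult (poly q x / node_prod S x) (\<Prod>y\<in>S - {x}. [:- y, 1:])) z
       = (if x = z then poly q z else 0)"
    proof (cases "x = z")
      case True
      then show ?thesis
        using node_prod_nonzero[OF assms(1), of z] by (simp add: poly_prod node_prod_def)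
    next
      case False
      then have "z \<in> S - {x}" using z by auto
      then have "(\<Prod>y\<in>S - {x}. z - y) = 0" using assms(1) by (auto)
      then show ?thesis using False by (simp add: poly_prod)
    qed
  qed
  also have "\<dots> = poly q z" using z assms by simp
  finally show "poly q z = poly ?L z" by simp
qed (use assms in auto)

text \<open>Compare coefficients of degree \<open>card S - 1\<close> in the interpolation formula:
  every Lagrange numerator is monic of that degree. In particular the sum vanishes for lower
  degrees.\<close>

lemma lagrange_coeff:
  fixes q :: "'a::field poly"
  assumes "finite S" "degree q < card S"
  shows "(\<Sum>x\<in>S. poly q x / node_prod S x) = Polynomial.coeff q (card S - 1)"
proof -
  have "Polynomial.coeff (\<Prod>y\<in>S - {x}. [:- y, 1:]) (card S - 1) = (1 :: 'a)" if "x \<in> S" for x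
  proof -
    have "degree (\<Prod>y\<in>S - {x}. [:- y, 1 :: 'a:]) = card S - 1"
      using that assms by (subst degree_prod_eq_sum_degree) auto
    moreover have "lead_coeff (\<Prod>y\<in>S - {x}. [:- y, 1 :: 'a:]) = 1"
      by (simp add: lead_coeff_prod)
    ultimately show ?thesis by simp
  qed
  then show ?thesis
    by (subst (2) lagrange_interpolation[OF assms]) (simp add: coeff_sum)
qed

text \<open>The partial fraction expansion of \<open>q\<close> over the product of the
  \<open>t - x\<close>, obtained by dividing the interpolation formula by that product.\<close>

lemma lagrange_eval:
  fixes q :: "'a::field poly"
  assumes "finite S" "degree q < card S" "t \<notin> S"
  shows "(\<Sum>x\<in>S. poly q x / (node_prod S x * (t - x))) = poly q t / (\<Prod>x\<in>S. t - x)"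
proof -
  have nz: "(\<Prod>x\<in>S. t - x) \<noteq> 0" using assms by auto
  have "poly q t = (\<Sum>x\<in>S. poly q x / node_prod S x * (\<Prod>y\<in>S - {x}. t - y))"
    by (subst lagrange_interpolation[OF assms(1,2)]) (simp add: poly_sum poly_prod)
  also have "\<dots> = (\<Sum>x\<in>S. poly q x / (node_prod S x * (t - x)) * (\<Prod>x\<in>S. t - x))"
  proof (intro sum.cong refl)
    fix x assume x: "x \<in> S"
    then have "(\<Prod>x\<in>S. t - x) = (t - x) * (\<Prod>y\<in>S - {x}. t - y)"
      using assms by (simp add: prod.remove)
    moreover have "t - x \<noteq> 0" using x assms by auto
    ultimately show "poly q x / node_prod S x * (\<Prod>y\<in>S - {x}. t - y)
       = poly q x / (node_prod S x * (t - x)) * (\<Prod>x\<in>S. t - x)" by simp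
  qed
  also have "\<dots> = (\<Sum>x\<in>S. poly q x / (node_prod S x * (t - x))) * (\<Prod>x\<in>S. t - x)"
    by (rule sum_distrib_right[symmetric])
  finally show ?thesis using nz by (simp add: nonzero_eq_divide_eq)
qed

text \<open>Cancelling \<open>y - x\<close> leaves a monic polynomial of degree
  \<open>card B - 1\<close>, whose divided difference over \<open>B\<close> is its leading
  coefficient. This and the next two identities supply the entries of the matrix products formed
  with \<open>u\<close> in \<open>interlacing\<close>.\<close>

lemma sum_node_prod_quotient_one:
  fixes A B :: "'a::field set"
  assumes "finite A" "finite B" "card A = card B" "A \<inter> B = {}" "x \<in> A"
  shows "(\<Sum>y\<in>B. (\<Prod>z\<in>A. y - z) / node_prod B y / (y - x)) = 1"
proof -
  define q where "q = (\<Prod>z\<in>A - {x}. [:- z, 1:])"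
  have deg: "degree q = card B - 1"
    unfolding q_def using assms by (subst degree_prod_eq_sum_degree) auto
  have mon: "lead_coeff q = 1" by (simp add: q_def lead_coeff_prod)
  have "card B > 0" using assms by (metis card_gt_0_iff empty_iff)
  have "(\<Prod>z\<in>A. y - z) / node_prod B y / (y - x) = poly q y / node_prod B y" if "y \<in> B" for y
  proof -
    have "y - x \<noteq> 0" using that assms by auto
    moreover have "(\<Prod>z\<in>A. y - z) = (y - x) * poly q y"
      using assms by (simp add: q_def poly_prod prod.remove)
    ultimately show ?thesis by simp
  qed
  then have "(\<Sum>y\<in>B. (\<Prod>z\<in>A. y - z) / node_prod B y / (y - x))
      = (\<Sum>y\<in>B. poly q y / node_prod B y)" by (rule sum.cong[OF refl])
  also have "\<dots> = 1"
    using lagrange_coeff[of B q] deg mon \<open>card B > 0\<close> assms(2) by simp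
  finally show ?thesis .
qed

text \<open>Two distinct factors cancel, and degree \<open>card B - 2\<close> is too small to leave
  a leading coefficient.\<close>

lemma sum_node_prod_quotient_zero:
  fixes A B :: "'a::field set"
  assumes "finite A" "finite B" "card A = card B" "A \<inter> B = {}" "x \<in> A" "x' \<in> A" "x \<noteq> x'"
  shows "(\<Sum>y\<in>B. (\<Prod>z\<in>A. y - z) / node_prod B y / ((y - x) * (y - x'))) = 0"
proof -
  define q where "q = (\<Prod>z\<in>A - {x} - {x'}. [:- z, 1:])"
  have "card {x, x'} \<le> card A" using assms by (intro card_mono) auto
  then have c2: "card B \<ge> 2" using assms by simp
  have deg: "degree q = card B - 2"
    unfolding q_def using assms by (subst degree_prod_eq_sum_degree) (auto simp: card_Diff_singleton_if)
  have "(\<Prod>z\<in>A. y - z) / node_prod B y / ((y - x) * (y - x')) = poly q y / node_prod B y"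
    if "y \<in> B" for y
  proof -
    have "y - x \<noteq> 0" "y - x' \<noteq> 0" using that assms by auto
    moreover have "(\<Prod>z\<in>A. y - z) = (y - x) * ((y - x') * poly q y)"
    proof -
      have "(\<Prod>z\<in>A. y - z) = (y - x) * (\<Prod>z\<in>A - {x}. y - z)"
        using assms by (simp add: prod.remove)
      also have "(\<Prod>z\<in>A - {x}. y - z) = (y - x') * (\<Prod>z\<in>A - {x} - {x'}. y - z)"
        using assms by (intro prod.remove) auto
      finally show ?thesis by (simp add: q_def poly_prod)
    qed
    ultimately show ?thesis by simp
  qed
  then have "(\<Sum>y\<in>B. (\<Prod>z\<in>A. y - z) / node_prod B y / ((y - x) * (y - x')))
      = (\<Sum>y\<in>B. poly q y / node_prod B y)" by (rule sum.cong[OF refl])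
  also have "\<dots> = 0"
    using lagrange_coeff[of B q] deg c2 assms(2) by (simp add: coeff_eq_0)
  finally show ?thesis .
qed

text \<open>The product over \<open>A\<close> contains \<open>y - x\<close> only once, so one factor
  survives in the denominator and the sum is a partial fraction expansion evaluated at the point
  \<open>x\<close> outside \<open>B\<close>.\<close>

lemma sum_node_prod_quotient_square:
  fixes A B :: "'a::field set"
  assumes "finite A" "finite B" "card A = card B" "A \<inter> B = {}" "x \<in> A"
  shows "(\<Sum>y\<in>B. (\<Prod>z\<in>A. y - z) / node_prod B y / ((y - x) * (y - x)))
     = - (node_prod A x / (\<Prod>y\<in>B. x - y))"
proof -
  define q where "q = (\<Prod>z\<in>A - {x}. [:- z, 1:])"
  have "card B > 0" using assms by (metis card_gt_0_iff empty_iff)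
  then have deg: "degree q < card B"
    unfolding q_def using assms by (subst degree_prod_eq_sum_degree) auto
  have "(\<Prod>z\<in>A. y - z) / node_prod B y / ((y - x) * (y - x))
      = - (poly q y / (node_prod B y * (x - y)))" if "y \<in> B" for y
  proof -
    have "y - x \<noteq> 0" using that assms by auto
    moreover have "(\<Prod>z\<in>A. y - z) = (y - x) * poly q y"
      using assms by (simp add: q_def poly_prod prod.remove)
    ultimately have "(\<Prod>z\<in>A. y - z) / node_prod B y / ((y - x) * (y - x))
      = poly q y / (node_prod B y * (y - x))" by simp
    also have "\<dots> = - (poly q y / (node_prod B y * - (y - x)))"
      by (simp del: minus_diff_eq)
    finally show ?thesis by simp
  qed
  then have "(\<Sum>y\<in>B. (\<Prod>z\<in>A. y - z) / node_prod B y / ((y - x) * (y - x)))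
      = - (\<Sum>y\<in>B. poly q y / (node_prod B y * (x - y)))"
    by (simp add: sum_negf[symmetric])
  also have "(\<Sum>y\<in>B. poly q y / (node_prod B y * (x - y))) = poly q x / (\<Prod>y\<in>B. x - y)"
    using assms deg by (intro lagrange_eval) auto
  also have "poly q x = node_prod A x" by (simp add: q_def poly_prod node_prod_def)
  finally show ?thesis .
qed

section \<open>Operator monotone functions and divided differences\<close>

lemma mat_adjoint_dim [simp]:
  "dim_row (mat_adjoint A) = dim_col A" "dim_col (mat_adjoint A) = dim_row A"
  by (simp_all add: mat_adjoint_def)

lemma mat_adjoint_carrier [simp]:
  "A \<in> carrier_mat n m \<Longrightarrow> mat_adjoint A \<in> carrier_mat m n"
  by (metis carrier_matD carrier_matI mat_adjoint_dim)

lemma mat_adjoint_index [simp]: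
  "i < dim_col A \<Longrightarrow> j < dim_row A \<Longrightarrow> mat_adjoint A $$ (i, j) = conjugate (A $$ (j, i))"
  by (simp add: mat_adjoint_def mat_of_rows_index)

text \<open>Two diagonalisations of \<open>X\<close> are intertwined by
  \<open>W = mat_adjoint U * V\<close>. A nonzero entry of \<open>W\<close> forces the two
  eigenvalues that it links to coincide, hence also their images under \<open>f\<close>, so
  \<open>W\<close> intertwines the transformed diagonal matrices as well.\<close>

lemma hermitian_fun_eq:
  assumes U: "U \<in> carrier_mat n n" "U * mat_adjoint U = 1\<^sub>m n"
    and X: "X = U * mat_diag n (\<lambda>i. complex_of_real (d i)) * mat_adjoint U"
  shows "hermitian_fun f X = U * mat_diag n (\<lambda>i. complex_of_real (f (d i))) * mat_adjoint U"
proof -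
  define D where "D d = mat_diag n (\<lambda>i. complex_of_real (d i))" for d :: "nat \<Rightarrow> real"
  have Dc [simp]: "D e \<in> carrier_mat n n" for e by (simp add: D_def)
  have n: "dim_row X = n" unfolding X using U(1) by simp
  have *: "B = U * D (f \<circ> d) * mat_adjoint U"
    if V: "V \<in> carrier_mat n n" "V * mat_adjoint V = 1\<^sub>m n"
      and XV: "X = V * D e * mat_adjoint V"
      and B: "B = V * D (f \<circ> e) * mat_adjoint V" for V e B
  proof -
    note c = U(1) V(1) mat_adjoint_carrier[OF U(1)] mat_adjoint_carrier[OF V(1)]
    have U': "mat_adjoint U * U = 1\<^sub>m n" and V': "mat_adjoint V * V = 1\<^sub>m n"
      by (rule mat_mult_left_right_inverse[OF U(1) mat_adjoint_carrier[OF U(1)] U(2)], rule mat_mult_left_right_inverse[OF V(1) mat_adjoint_carrier[OF V(1)] V(2)])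
    define W where "W = mat_adjoint U * V"
    have Wc: "W \<in> carrier_mat n n" using c by (auto simp: W_def)
    note assoc = assoc_mult_mat[of _ n n _ n _ n]
    note mc [simp] = mult_carrier_mat[of _ n n _ n]
    have "D d * W = mat_adjoint U * U * (D d * W)"
      using c Wc by (simp add: U' left_mult_one_mat[of _ n n])
    also have "\<dots> = mat_adjoint U * X * V"
      using c by (simp add: X D_def[symmetric] W_def assoc)
    also have "\<dots> = mat_adjoint U * V * D e * (mat_adjoint V * V)"
      using c by (simp add: XV assoc)
    also have "\<dots> = W * D e" using c Wc by (simp add: V' W_def right_mult_one_mat[of _ n n])
    finally have DW: "D d * W = W * D e" .
    have DWf: "D (f \<circ> d) * W = W * D (f \<circ> e)"
    proof (rule eq_matI)
      fix i j assume "i < dim_row (W * D (f \<circ> e))" "j < dim_col (W * D (f \<circ> e))"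
      then have ij: "i < n" "j < n" using carrier_matD[OF mc[OF Wc Dc]] by auto
      have "(D d * W) $$ (i, j) = (W * D e) $$ (i, j)" using DW by simp
      then have "of_real (d i) * W $$ (i, j) = W $$ (i, j) * of_real (e j)"
        using ij Wc by (simp add: D_def mat_diag_mult_left[OF Wc] mat_diag_mult_right[OF Wc])
      then have "W $$ (i, j) = 0 \<or> d i = e j" by (auto simp: mult.commute)
      then show "(D (f \<circ> d) * W) $$ (i, j) = (W * D (f \<circ> e)) $$ (i, j)"
        using ij Wc by (auto simp: D_def mat_diag_mult_left[OF Wc] mat_diag_mult_right[OF Wc])
    qed (simp_all only: carrier_matD[OF mc[OF Wc Dc]] carrier_matD[OF mc[OF Dc Wc]])
    have "B = U * mat_adjoint U * (V * D (f \<circ> e) * mat_adjoint V)"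
      using c unfolding U B by (intro left_mult_one_mat[of _ n n, symmetric]) auto
    also have "\<dots> = U * (W * D (f \<circ> e)) * mat_adjoint V"
      using c by (simp add: W_def assoc)
    also have "\<dots> = U * (D (f \<circ> d) * W) * mat_adjoint V"
      by (simp only: DWf)
    also have "\<dots> = U * D (f \<circ> d) * mat_adjoint U * (V * mat_adjoint V)"
      using c by (simp add: W_def assoc)
    also have "\<dots> = U * D (f \<circ> d) * mat_adjoint U"
      using c by (simp add: V right_mult_one_mat[of _ n n])
    finally show ?thesis .
  qed
  show ?thesis
    unfolding hermitian_fun_def n
  proof (rule someI2_ex)
    fix B assume "\<exists>V e. V \<in> carrier_mat n n \<and> V * mat_adjoint V = 1\<^sub>m n \<and>
      X = V * mat_diag n (\<lambda>i. complex_of_real (e i)) * mat_adjoint V \<and>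
      B = V * mat_diag n (\<lambda>i. complex_of_real (f (e i))) * mat_adjoint V"
    then show "B = U * mat_diag n (\<lambda>i. complex_of_real (f (d i))) * mat_adjoint U"
      by (elim exE conjE) (rule *[unfolded D_def o_def])
  qed (intro exI conjI, rule U(1), rule U(2), rule X, rule refl)
qed

lemma cscalar_prod_mult_mat_vec:
  assumes "A \<in> carrier_mat n n" "x \<in> carrier_vec n" "y \<in> carrier_vec n"
  shows "(A *\<^sub>v x) \<bullet>c y = (\<Sum>i<n. \<Sum>k<n. A $$ (i, k) * x $ k * cnj (y $ i))"
proof -
  have "(A *\<^sub>v x) \<bullet>c y = (\<Sum>i<n. (A *\<^sub>v x) $ i * cnj (y $ i))"
    using assms by (simp add: scalar_prod_def atLeast0LessThan)
  also have "\<dots> = (\<Sum>i<n. (\<Sum>k<n. A $$ (i, k) * x $ k) * cnj (y $ i))"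
    using assms by (intro sum.cong refl) (auto simp: scalar_prod_def atLeast0LessThan)
  finally show ?thesis by (simp add: sum_distrib_right)
qed

lemma sum_rank_one_form:
  fixes u :: "nat \<Rightarrow> nat \<Rightarrow> real"
  shows "(\<Sum>i<n. \<Sum>k<n. (\<Sum>j<n. u i j * d j * u k j) * z k * z i)
    = (\<Sum>j<n. d j * (\<Sum>i<n. z i * u i j)\<^sup>2)"
proof -
  have "(\<Sum>i<n. \<Sum>k<n. (\<Sum>j<n. u i j * d j * u k j) * z k * z i)
     = (\<Sum>i<n. \<Sum>k<n. \<Sum>j<n. d j * ((z i * u i j) * (z k * u k j)))"
    by (simp add: sum_distrib_right sum_distrib_left mult_ac)
  also have "\<dots> = (\<Sum>i<n. \<Sum>j<n. \<Sum>k<n. d j * ((z i * u i j) * (z k * u k j)))"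
    by (intro sum.cong refl sum.swap)
  also have "\<dots> = (\<Sum>j<n. \<Sum>i<n. \<Sum>k<n. d j * ((z i * u i j) * (z k * u k j)))"
    by (rule sum.swap)
  also have "\<dots> = (\<Sum>j<n. d j * (\<Sum>i<n. z i * u i j)\<^sup>2)"
    unfolding power2_eq_square sum_product by (simp only: sum_distrib_left)
  finally show ?thesis .
qed

text \<open>A rank-one perturbation \<open>diag a + v v\<^sup>T\<close> with prescribed eigenvalues \<open>b\<close>: its
  eigenvectors are the columns of the Cauchy-like matrix \<open>u\<close>.\<close>

locale interlacing =
  fixes n :: nat and a b :: "nat \<Rightarrow> real"
  assumes less: "\<And>i. i < n \<Longrightarrow> a i < b i"
    and step: "\<And>i j. i < j \<Longrightarrow> j < n \<Longrightarrow> b i < a j"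
begin

abbreviation "SA \<equiv> a ` {..<n}"
abbreviation "SB \<equiv> b ` {..<n}"

text \<open>Let g be the product of the \<open>X - b j\<close> divided by the product of the
  \<open>X - a i\<close>. For the perturbed matrix to have eigenvalues \<open>b\<close>, g must be 1
  minus the sum of \<open>(v i)^2 / (X - a i)\<close>; so \<open>(v i)^2\<close> is minus the
  residue of g at \<open>a i\<close>. The residue of 1/g at \<open>b j\<close> is
  \<open>(w j)^2\<close>, which normalises the eigenvector with entries
  \<open>v i / (b j - a i)\<close>.\<close>

definition "v i = sqrt (- (\<Prod>y\<in>SB. a i - y) / node_prod SA (a i))"
definition "w j = sqrt ((\<Prod>z\<in>SA. b j - z) / node_prod SB (b j))"
definition "u i j = v i * w j / (b j - a i)"

lemma inj_a: "inj_on a {..<n}"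
proof (rule linorder_inj_onI)
  fix i j assume "i < j" "i \<in> {..<n}" "j \<in> {..<n}"
  then show "a i \<noteq> a j" using less[of i] step[of i j] by auto
qed auto

lemma inj_b: "inj_on b {..<n}"
proof (rule linorder_inj_onI)
  fix i j assume "i < j" "i \<in> {..<n}" "j \<in> {..<n}"
  then show "b i \<noteq> b j" using less[of j] step[of i j] by auto
qed auto

lemma a_neq_b: "i < n \<Longrightarrow> j < n \<Longrightarrow> a i \<noteq> b j"
  using less[of i] less[of j] step[of i j] step[of j i] by (cases i j rule: linorder_cases) auto

lemma disjoint: "SA \<inter> SB = {}"
  using a_neq_b by auto

lemma node_prod_a: "i < n \<Longrightarrow> node_prod SA (a i) = (\<Prod>k\<in>{..<n} - {i}. a i - a k)"
proof -
  assume i: "i < n"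
  have "SA - {a i} = a ` ({..<n} - {i})" using i inj_a by (auto simp: inj_on_def)
  then show ?thesis
    unfolding node_prod_def by (simp add: prod.reindex inj_on_subset[OF inj_a])
qed

lemma node_prod_b: "i < n \<Longrightarrow> node_prod SB (b i) = (\<Prod>k\<in>{..<n} - {i}. b i - b k)"
proof -
  assume i: "i < n"
  have "SB - {b i} = b ` ({..<n} - {i})" using i inj_b by (auto simp: inj_on_def)
  then show ?thesis
    unfolding node_prod_def by (simp add: prod.reindex inj_on_subset[OF inj_b])
qed

text \<open>For \<open>k\<close> other than \<open>i\<close>, interlacing puts \<open>a k\<close>
  and \<open>b k\<close> on the same side of \<open>a i\<close>, so each paired quotient is
  positive; the unpaired factor \<open>a i - b i\<close> is negative and absorbs the minus
  sign.\<close>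

lemma v_square_pos:
  assumes i: "i < n" shows "- (\<Prod>y\<in>SB. a i - y) / node_prod SA (a i) > 0"
proof -
  have neg: "- ((x - y) * p) / q = (y - x) * (p / q)" for x y p q :: real
    by (cases "q = 0") (simp_all add: field_simps)
  have "(\<Prod>y\<in>SB. a i - y) = (a i - b i) * (\<Prod>k\<in>{..<n} - {i}. a i - b k)"
    using i by (simp add: prod.reindex[OF inj_b] prod.remove)
  then have eq: "- (\<Prod>y\<in>SB. a i - y) / node_prod SA (a i)
      = (b i - a i) * (\<Prod>k\<in>{..<n} - {i}. (a i - b k) / (a i - a k))"
    using neg by (simp only: node_prod_a[OF i] prod_dividef)
  show ?thesis unfolding eq
  proof (intro mult_pos_pos prod_pos)
    fix k assume k: "k \<in> {..<n} - {i}"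
    show "(a i - b k) / (a i - a k) > 0"
      using less[of i] less[of k] step[of i k] step[of k i] k i
      by (cases i k rule: linorder_cases) (auto intro: divide_neg_neg divide_pos_pos)
  qed (use less i in auto)
qed

lemma w_square_pos:
  assumes i: "i < n" shows "(\<Prod>y\<in>SA. b i - y) / node_prod SB (b i) > 0"
proof -
  have "(\<Prod>y\<in>SA. b i - y) = (b i - a i) * (\<Prod>k\<in>{..<n} - {i}. b i - a k)"
    using i by (simp add: prod.reindex[OF inj_a] prod.remove)
  then have eq: "(\<Prod>y\<in>SA. b i - y) / node_prod SB (b i)
      = (b i - a i) * (\<Prod>k\<in>{..<n} - {i}. (b i - a k) / (b i - b k))"
    using i by (simp add: node_prod_b prod_dividef)
  show ?thesis unfolding eq
  proof (intro mult_pos_pos prod_pos)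
    fix k assume k: "k \<in> {..<n} - {i}"
    show "(b i - a k) / (b i - b k) > 0"
      using less[of i] less[of k] step[of i k] step[of k i] k i
      by (cases i k rule: linorder_cases) (auto intro: divide_neg_neg divide_pos_pos)
  qed (use less i in auto)
qed

lemma v_square: "i < n \<Longrightarrow> v i * v i = - (\<Prod>y\<in>SB. a i - y) / node_prod SA (a i)"
  and v_nonzero: "i < n \<Longrightarrow> v i \<noteq> 0"
  and w_square: "i < n \<Longrightarrow> w i * w i = (\<Prod>y\<in>SA. b i - y) / node_prod SB (b i)"
  using v_square_pos[of i] w_square_pos[of i]
  by (simp_all only: v_def w_def real_sqrt_mult_self abs_of_pos)
     (metis less_irrefl real_sqrt_gt_zero)

lemma sum_SB: "(\<Sum>y\<in>SB. g y) = (\<Sum>j<n. g (b j))"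
  by (simp add: sum.reindex[OF inj_b])

text \<open>The \<open>v\<close> factors come out of the sum, and the remaining weights
  \<open>(w j)^2\<close> are those of the quotient identities over \<open>SB\<close>. The diagonal
  value given there is exactly \<open>1 / (v i * v i)\<close>.\<close>

lemma u_orthogonal:
  assumes "i < n" "k < n"
  shows "(\<Sum>j<n. u i j * u k j) = (if i = k then 1 else 0)"
proof -
  have card: "card SA = card SB" by (simp add: card_image inj_a inj_b)
  have "(\<Sum>j<n. u i j * u k j)
    = v i * v k * (\<Sum>j<n. (w j * w j) / ((b j - a i) * (b j - a k)))"
    by (simp add: u_def sum_distrib_left mult_ac)
  also have "(\<Sum>j<n. (w j * w j) / ((b j - a i) * (b j - a k)))
    = (\<Sum>y\<in>SB. (\<Prod>z\<in>SA. y - z) / node_prod SB y / ((y - a i) * (y - a k)))"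
    unfolding sum_SB by (intro sum.cong refl) (simp add: w_square)
  finally have eq: "(\<Sum>j<n. u i j * u k j) = v i * v k *
    (\<Sum>y\<in>SB. (\<Prod>z\<in>SA. y - z) / node_prod SB y / ((y - a i) * (y - a k)))" .
  show ?thesis
  proof (cases "i = k")
    case True
    have "(\<Sum>y\<in>SB. (\<Prod>z\<in>SA. y - z) / node_prod SB y / ((y - a i) * (y - a i)))
      = - (node_prod SA (a i) / (\<Prod>y\<in>SB. a i - y))"
      using assms card disjoint by (intro sum_node_prod_quotient_square) auto
    also have "\<dots> = 1 / (v i * v i)"
      unfolding v_square[OF assms(1)] by simp
    finally show ?thesis using eq True v_nonzero[OF assms(1)] by simp
  next
    case False
    then have "a i \<noteq> a k" using inj_a assms by (auto simp: inj_on_def)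
    then have "(\<Sum>y\<in>SB. (\<Prod>z\<in>SA. y - z) / node_prod SB y / ((y - a i) * (y - a k))) = 0"
      using assms card disjoint by (intro sum_node_prod_quotient_zero) auto
    then show ?thesis using eq False by simp
  qed
qed

text \<open>Since \<open>u i j * (b j - a i) = v i * w j\<close>, the factor \<open>b j\<close> may
  be traded for \<open>a i\<close> plus a term whose sum over \<open>j\<close> is the quotient
  identity with value 1; the rest is orthogonality.\<close>

lemma u_diagonalizes:
  assumes "i < n" "k < n"
  shows "(\<Sum>j<n. u i j * b j * u k j) = (if i = k then a i else 0) + v i * v k"
proof -
  have card: "card SA = card SB" by (simp add: card_image inj_a inj_b)
  have "(\<Sum>j<n. u i j * b j * u k j)
    = (\<Sum>j<n. a i * (u i j * u k j) + v i * v k * ((w j * w j) / (b j - a k)))"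
  proof (intro sum.cong refl)
    fix j assume "j \<in> {..<n}"
    then have nz: "b j - a i \<noteq> 0" using a_neq_b[of i j] assms by auto
    have "u i j * b j * u k j = a i * (u i j * u k j) + (u i j * (b j - a i)) * u k j"
      by (simp add: algebra_simps)
    also have "u i j * (b j - a i) = v i * w j" using nz by (simp add: u_def)
    finally show "u i j * b j * u k j
      = a i * (u i j * u k j) + v i * v k * ((w j * w j) / (b j - a k))"
      by (simp add: u_def mult_ac)
  qed
  also have "\<dots> = a i * (\<Sum>j<n. u i j * u k j) + v i * v k * (\<Sum>j<n. (w j * w j) / (b j - a k))"
    by (simp add: sum.distrib sum_distrib_left)
  also have "(\<Sum>j<n. (w j * w j) / (b j - a k))
    = (\<Sum>y\<in>SB. (\<Prod>z\<in>SA. y - z) / node_prod SB y / (y - a k))"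
    unfolding sum_SB by (intro sum.cong refl) (simp add: w_square)
  also have "\<dots> = 1"
    using assms card disjoint by (intro sum_node_prod_quotient_one) auto
  finally show ?thesis by (simp add: u_orthogonal assms)
qed

text \<open>Monotonicity is applied to the diagonal matrix \<open>X\<close> and its rank-one
  perturbation \<open>Y\<close>. The matrix inequality is then tested on one real vector for which
  the two quadratic forms become the two parts of a divided difference over \<open>SA\<close> and
  \<open>SB\<close> together.\<close>

lemma operator_monotone_divided_difference:
  assumes f: "operator_monotone f" and pos: "\<And>i. i < n \<Longrightarrow> 0 < a i" and p: "degree p < n"
  shows "0 \<le> (\<Sum>x\<in>SA. f x * (poly p x)\<^sup>2 / (node_prod SA x * (\<Prod>y\<in>SB. x - y)))
            + (\<Sum>x\<in>SB. f x * (poly p x)\<^sup>2 / (node_prod SB x * (\<Prod>y\<in>SA. x - y)))"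
proof -
  define U where "U = mat n n (\<lambda>(i, j). complex_of_real (u i j))"
  define X where "X = mat_diag n (\<lambda>i. complex_of_real (a i))"
  define Y where "Y = mat n n (\<lambda>(i, j). complex_of_real ((if i = j then a i else 0) + v i * v j))"
  define G where "G = mat n n (\<lambda>(i, j). complex_of_real (\<Sum>k<n. u i k * f (b k) * u j k))"
  have Uc: "U \<in> carrier_mat n n" by (simp add: U_def)
  have UD: "U * mat_diag n (\<lambda>i. complex_of_real (d i))
     = mat n n (\<lambda>(i, j). complex_of_real (u i j * d j))" for d
    unfolding mat_diag_mult_right[OF Uc] by (rule eq_matI) (auto simp: U_def)
  have UDU: "U * mat_diag n (\<lambda>i. complex_of_real (d i)) * mat_adjoint U
     = mat n n (\<lambda>(i, j). complex_of_real (\<Sum>k<n. u i k * d k * u j k))" for d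
  proof (rule eq_matI)
    fix i j assume "i < dim_row (mat n n (\<lambda>(i, j). complex_of_real (\<Sum>k<n. u i k * d k * u j k)))"
      "j < dim_col (mat n n (\<lambda>(i, j). complex_of_real (\<Sum>k<n. u i k * d k * u j k)))"
    then show "(U * mat_diag n (\<lambda>i. complex_of_real (d i)) * mat_adjoint U) $$ (i, j) =
      mat n n (\<lambda>(i, j). complex_of_real (\<Sum>k<n. u i k * d k * u j k)) $$ (i, j)"
      unfolding UD by (simp add: scalar_prod_def U_def atLeast0LessThan)
  qed (auto simp: U_def)
  have UU: "U * mat_adjoint U = 1\<^sub>m n"
  proof -
    have "U * mat_adjoint U = U * mat_diag n (\<lambda>i. complex_of_real 1) * mat_adjoint U"
      using Uc by simp
    also have "\<dots> = 1\<^sub>m n" unfolding UDU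
      by (rule eq_matI) (auto simp: u_orthogonal simp del: of_real_sum of_real_mult)
    finally show ?thesis .
  qed
  have Y: "Y = U * mat_diag n (\<lambda>i. complex_of_real (b i)) * mat_adjoint U"
    unfolding UDU Y_def by (rule eq_matI) (auto simp: u_diagonalizes simp del: of_real_sum of_real_mult)
  have hY: "hermitian_fun f Y = G"
    using hermitian_fun_eq[OF Uc UU Y, of f] unfolding UDU G_def by simp
  have adj1: "mat_adjoint (1\<^sub>m n) = (1\<^sub>m n :: complex mat)" by (rule eq_matI) auto
  have hX: "hermitian_fun f X = mat_diag n (\<lambda>i. complex_of_real (f (a i)))"
    using hermitian_fun_eq[of "1\<^sub>m n" n X a f] by (simp add: X_def adj1 left_mult_one_mat[of _ n n] right_mult_one_mat[of _ n n])
  have qf: "Re ((M *\<^sub>v x) \<bullet>c x) = (\<Sum>i<n. \<Sum>k<n. Re (m i k * x $ k * cnj (x $ i)))"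
    if "x \<in> carrier_vec n" "M = mat n n (\<lambda>(i, j). m i j)" for M x and m :: "nat \<Rightarrow> nat \<Rightarrow> complex"
    using that by (subst cscalar_prod_mult_mat_vec[of _ n]) auto
  have sq: "Re (x * cnj x) = (cmod x)\<^sup>2" for x
    by (simp add: complex_mult_cnj cmod_power2)
  have YX: "Y - X = mat n n (\<lambda>(i, j). complex_of_real (v i * v j))"
    by (rule eq_matI) (auto simp: X_def Y_def mat_diag_def)
  have rank1: "0 \<le> (\<Sum>i<n. \<Sum>k<n. Re (complex_of_real (v i * v k) * x $ k * cnj (x $ i)))"
    for x :: "complex vec"
  proof -
    have "(\<Sum>i<n. \<Sum>k<n. Re (complex_of_real (v i * v k) * x $ k * cnj (x $ i)))
      = Re ((\<Sum>k<n. v k * x $ k) * cnj (\<Sum>i<n. v i * x $ i))"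
      unfolding sum_product cnj_sum Re_sum by (subst sum.swap) (simp add: mult_ac)
    then show ?thesis by (simp only: sq zero_le_power2)
  qed
  have diag: "(\<Sum>i<n. \<Sum>k<n. Re ((if i = k then complex_of_real (d i) else 0) * x $ k * cnj (x $ i)))
      = (\<Sum>i<n. d i * (cmod (x $ i))\<^sup>2)" for d and x :: "complex vec"
  proof (intro sum.cong refl)
    fix i assume "i \<in> {..<n}"
    then have "(\<Sum>k<n. Re ((if i = k then complex_of_real (d i) else 0) * x $ k * cnj (x $ i)))
       = (\<Sum>k<n. if k = i then Re (d i * (x $ i * cnj (x $ i))) else 0)"
      by (intro sum.cong refl) (auto simp: mult_ac)
    also have "\<dots> = d i * (cmod (x $ i))\<^sup>2"
      using \<open>i \<in> {..<n}\<close> sq[of "x $ i"] by simp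
    finally show "(\<Sum>k<n. Re ((if i = k then complex_of_real (d i) else 0) * x $ k * cnj (x $ i)))
       = d i * (cmod (x $ i))\<^sup>2" .
  qed
  have diag_pos: "0 < (\<Sum>i<n. a i * (cmod (x $ i))\<^sup>2)"
    if x: "x \<in> carrier_vec n" "x \<noteq> 0\<^sub>v n" for x
  proof -
    obtain i where "i < n" "x $ i \<noteq> 0"
      using x by (metis carrier_vecD eq_vecI index_zero_vec(1) index_zero_vec(2))
    then show ?thesis
      using pos by (intro sum_pos2[of _ i]) (auto simp: less_imp_le)
  qed
  have Xmat: "X = mat n n (\<lambda>(i, j). if i = j then complex_of_real (a i) else 0)"
    by (rule eq_matI) (auto simp: X_def mat_diag_def)
  have posX: "pos_def X"
    unfolding pos_def_def hermitian_mat_def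
  proof (intro conjI ballI impI)
    show "mat_adjoint X = X" by (rule eq_matI) (auto simp: Xmat)
    fix x :: "complex vec" assume "x \<in> carrier_vec (dim_row X)" "x \<noteq> 0\<^sub>v (dim_row X)"
    then have x: "x \<in> carrier_vec n" "x \<noteq> 0\<^sub>v n" by (auto simp: Xmat)
    show "0 < Re ((X *\<^sub>v x) \<bullet>c x)"
      unfolding qf[OF x(1) Xmat] diag using diag_pos[OF x] .
  qed
  have posY: "pos_def Y"
    unfolding pos_def_def hermitian_mat_def
  proof (intro conjI ballI impI)
    show "mat_adjoint Y = Y" by (rule eq_matI) (auto simp: Y_def mult.commute)
    fix x :: "complex vec" assume "x \<in> carrier_vec (dim_row Y)" "x \<noteq> 0\<^sub>v (dim_row Y)"
    then have x: "x \<in> carrier_vec n" "x \<noteq> 0\<^sub>v n" by (auto simp: Y_def)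
    have "Re ((Y *\<^sub>v x) \<bullet>c x) = (\<Sum>i<n. \<Sum>k<n. Re ((if i = k then complex_of_real (a i) else 0) * x $ k * cnj (x $ i)))
       + (\<Sum>i<n. \<Sum>k<n. Re (complex_of_real (v i * v k) * x $ k * cnj (x $ i)))"
      unfolding qf[OF x(1) Y_def] sum.distrib[symmetric]
      by (intro sum.cong refl) (simp add: ring_distribs)
    then show "0 < Re ((Y *\<^sub>v x) \<bullet>c x)"
      unfolding diag using diag_pos[OF x] rank1[of x] by linarith
  qed
  have "pos_semidef (Y - X)"
    unfolding pos_semidef_def hermitian_mat_def YX
  proof (intro conjI ballI)
    show "mat_adjoint (mat n n (\<lambda>(i, j). complex_of_real (v i * v j)))
       = mat n n (\<lambda>(i, j). complex_of_real (v i * v j))"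
      by (rule eq_matI) (auto simp: mult.commute)
    fix x :: "complex vec" assume "x \<in> carrier_vec (dim_row (mat n n (\<lambda>(i, j). complex_of_real (v i * v j))))"
    then have x: "x \<in> carrier_vec n" by simp
    show "0 \<le> Re ((mat n n (\<lambda>(i, j). complex_of_real (v i * v j)) *\<^sub>v x) \<bullet>c x)"
      unfolding qf[OF x refl] by (rule rank1)
  qed
  then have mono: "pos_semidef (G - mat_diag n (\<lambda>i. complex_of_real (f (a i))))"
    using f[unfolded operator_monotone_def, rule_format, of X n Y] posX posY hX hY
    by (simp add: X_def Y_def)
  \<comment> \<open>\<open>v i\<close> cancels the one in \<open>u\<close>, so pairing
    \<open>z\<close> with the eigenvector of index \<open>j\<close> is the partial fraction
    expansion of \<open>p\<close> over the nodes \<open>a\<close>, taken at \<open>b j\<close>; this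
    rests on \<open>degree p < n\<close>.\<close>
  define z where "z i = poly p (a i) / (v i * node_prod SA (a i))" for i
  define x where "x = vec n (\<lambda>i. complex_of_real (z i))"
  have x: "x \<in> carrier_vec n" by (simp add: x_def)
  have GX: "G - mat_diag n (\<lambda>i. complex_of_real (f (a i))) = mat n n (\<lambda>(i, j).
      complex_of_real ((\<Sum>k<n. u i k * f (b k) * u j k) - (if i = j then f (a i) else 0)))"
    by (rule eq_matI) (auto simp: G_def mat_diag_def)
  have "0 \<le> Re (((G - mat_diag n (\<lambda>i. complex_of_real (f (a i)))) *\<^sub>v x) \<bullet>c x)"
    using mono x unfolding GX pos_semidef_def by simp
  also have "\<dots> = (\<Sum>i<n. \<Sum>k<n. (\<Sum>j<n. u i j * f (b j) * u k j) * z k * z i)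
     - (\<Sum>i<n. \<Sum>k<n. (if i = k then f (a i) else 0) * z k * z i)"
    unfolding qf[OF x GX] sum_subtractf[symmetric]
    by (intro sum.cong refl) (simp add: x_def ring_distribs)
  also have "(\<Sum>i<n. \<Sum>k<n. (if i = k then f (a i) else 0) * z k * z i) = (\<Sum>i<n. f (a i) * (z i)\<^sup>2)"
    by (intro sum.cong refl) (simp add: if_distrib[of "\<lambda>t. t * _"] power2_eq_square cong: if_cong)
  also have "(\<Sum>i<n. \<Sum>k<n. (\<Sum>j<n. u i j * f (b j) * u k j) * z k * z i)
     = (\<Sum>j<n. f (b j) * (\<Sum>i<n. z i * u i j)\<^sup>2)"
    by (rule sum_rank_one_form)
  also have "\<dots> = (\<Sum>j<n. f (b j) * (poly p (b j))\<^sup>2 / (node_prod SB (b j) * (\<Prod>y\<in>SA. b j - y)))"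
  proof (intro sum.cong refl)
    fix j assume "j \<in> {..<n}"
    then have j: "j < n" by simp
    have "(\<Sum>i<n. z i * u i j) = w j * (\<Sum>i<n. poly p (a i) / (node_prod SA (a i) * (b j - a i)))"
      unfolding sum_distrib_left
      by (intro sum.cong refl) (simp add: z_def u_def v_nonzero)
    also have "(\<Sum>i<n. poly p (a i) / (node_prod SA (a i) * (b j - a i)))
        = (\<Sum>x\<in>SA. poly p x / (node_prod SA x * (b j - x)))"
      by (simp add: sum.reindex[OF inj_a])
    also have "\<dots> = poly p (b j) / (\<Prod>y\<in>SA. b j - y)"
      using j disjoint p by (intro lagrange_eval) (auto simp: card_image inj_a)
    finally have "(\<Sum>i<n. z i * u i j)\<^sup>2
       = (w j * w j) * (poly p (b j))\<^sup>2 / ((\<Prod>y\<in>SA. b j - y) * (\<Prod>y\<in>SA. b j - y))"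
      by (simp add: power2_eq_square)
    \<comment> \<open>\<open>w j\<close> squared absorbs one of the two products and contributes
      \<open>node_prod SB (b j)\<close>.\<close>
    also have "\<dots> = (poly p (b j))\<^sup>2 / (node_prod SB (b j) * (\<Prod>y\<in>SA. b j - y))"
      using w_square_pos[OF j] unfolding w_square[OF j] by simp
    finally show "f (b j) * (\<Sum>i<n. z i * u i j)\<^sup>2
      = f (b j) * (poly p (b j))\<^sup>2 / (node_prod SB (b j) * (\<Prod>y\<in>SA. b j - y))" by simp
  qed
  also have "(\<Sum>i<n. f (a i) * (z i)\<^sup>2)
     = - (\<Sum>i<n. f (a i) * (poly p (a i))\<^sup>2 / (node_prod SA (a i) * (\<Prod>y\<in>SB. a i - y)))"
    unfolding sum_negf[symmetric]
  proof (intro sum.cong refl)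
    fix i assume "i \<in> {..<n}"
    then have i: "i < n" by simp
    have "(z i)\<^sup>2 = (poly p (a i))\<^sup>2 / ((v i * v i) * (node_prod SA (a i) * node_prod SA (a i)))"
      by (simp add: z_def power2_eq_square mult_ac)
    also have "\<dots> = - ((poly p (a i))\<^sup>2 / (node_prod SA (a i) * (\<Prod>y\<in>SB. a i - y)))"
      using v_square_pos[OF i] unfolding v_square[OF i] by (simp add: mult_ac)
    finally show "f (a i) * (z i)\<^sup>2
       = - (f (a i) * (poly p (a i))\<^sup>2 / (node_prod SA (a i) * (\<Prod>y\<in>SB. a i - y)))" by simp
  qed
  finally show ?thesis
    by (simp add: sum.reindex[OF inj_a] sum.reindex[OF inj_b])
qed

end

section \<open>Nonnegative polynomials on the half-line\<close>

text \<open>The degree index bounds every summand separately, so that it is additive under products.\<close>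

inductive stieltjes_sos :: "nat \<Rightarrow> real poly \<Rightarrow> bool" for n where
  zero: "stieltjes_sos n 0"
| add_square: "stieltjes_sos n P \<Longrightarrow> 2 * degree a \<le> n \<Longrightarrow> stieltjes_sos n (P + a\<^sup>2)"
| add_X_square: "stieltjes_sos n P \<Longrightarrow> 2 * degree b + 1 \<le> n \<Longrightarrow> stieltjes_sos n (P + [:0, 1:] * b\<^sup>2)"

lemma stieltjes_sos_square: "2 * degree a \<le> n \<Longrightarrow> stieltjes_sos n (a\<^sup>2)"
  using add_square[OF zero] by simp

lemma stieltjes_sos_mono: "stieltjes_sos m P \<Longrightarrow> m \<le> n \<Longrightarrow> stieltjes_sos n P"
  by (induction rule: stieltjes_sos.induct) (auto simp del: mult_pCons_left intro: stieltjes_sos.intros)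

lemma stieltjes_sos_add:
  assumes "stieltjes_sos n Q" "stieltjes_sos n P"
  shows "stieltjes_sos n (P + Q)"
  using assms(1)
  by (induction rule: stieltjes_sos.induct)
     (use assms(2) in \<open>auto simp: add.assoc[symmetric] simp del: mult_pCons_left intro: stieltjes_sos.intros\<close>)

lemma stieltjes_sos_mult_square:
  assumes "stieltjes_sos n P" "2 * degree c \<le> m"
  shows "stieltjes_sos (n + m) (P * c\<^sup>2)"
  using assms(1)
proof (induction rule: stieltjes_sos.induct)
  case zero
  then show ?case by (simp add: stieltjes_sos.zero)
next
  case (add_square P a)
  have "2 * degree (a * c) \<le> n + m"
    using degree_mult_le[of a c] add_square.hyps assms(2) by linarith
  from stieltjes_sos.add_square[OF add_square.IH this] show ?case
    by (simp add: algebra_simps power_mult_distrib)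
next
  case (add_X_square P b)
  have "2 * degree (b * c) + 1 \<le> n + m"
    using degree_mult_le[of b c] add_X_square.hyps assms(2) by linarith
  from stieltjes_sos.add_X_square[OF add_X_square.IH this] show ?case
    by (simp add: ring_distribs power_mult_distrib mult_ac del: mult_pCons_left mult_pCons_right)
qed

lemma stieltjes_sos_mult_X_square:
  assumes "stieltjes_sos n P" "2 * degree c + 1 \<le> m"
  shows "stieltjes_sos (n + m) (P * ([:0, 1:] * c\<^sup>2))"
  using assms(1)
proof (induction rule: stieltjes_sos.induct)
  case zero
  then show ?case by (simp add: stieltjes_sos.zero)
next
  case (add_square P a)
  have "2 * degree (a * c) + 1 \<le> n + m"
    using degree_mult_le[of a c] add_square.hyps assms(2) by linarith
  from stieltjes_sos.add_X_square[OF add_square.IH this] show ?case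
    by (simp add: ring_distribs power_mult_distrib mult_ac del: mult_pCons_left mult_pCons_right)
next
  case (add_X_square P b)
  \<comment> \<open>\<open>X b^2\<close> times \<open>X c^2\<close> is the square of
    \<open>X b c\<close>; the two \<open>+ 1\<close> in the degree bounds pay for twice the degree
    of the new factor \<open>X\<close>.\<close>
  have "degree ([:0, 1:] * (b * c)) \<le> 1 + (degree b + degree c)"
    using degree_mult_le[of "[:0, 1:]" "b * c"] degree_mult_le[of b c] by (auto simp del: mult_pCons_left)
  then have "2 * degree ([:0, 1:] * (b * c)) \<le> n + m"
    using add_X_square.hyps assms(2) by linarith
  from stieltjes_sos.add_square[OF add_X_square.IH this] show ?case
    by (simp add: ring_distribs power_mult_distrib power2_eq_square mult_ac del: mult_pCons_left mult_pCons_right)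
qed

lemma stieltjes_sos_mult:
  assumes "stieltjes_sos m Q" "stieltjes_sos n P"
  shows "stieltjes_sos (n + m) (P * Q)"
  using assms(1)
proof (induction rule: stieltjes_sos.induct)
  case zero
  then show ?case by (simp add: stieltjes_sos.zero)
next
  case (add_square Q a)
  then show ?case
    using stieltjes_sos_add[OF stieltjes_sos_mult_square[OF assms(2), of a m]]
    by (simp add: ring_distribs)
next
  case (add_X_square Q b)
  then show ?case
    using stieltjes_sos_add[OF stieltjes_sos_mult_X_square[OF assms(2), of b m]]
    by (simp add: ring_distribs del: mult_pCons_left mult_pCons_right)
qed

lemma of_real_poly_add:
  "map_poly complex_of_real (p + q) = map_poly complex_of_real p + map_poly complex_of_real q"
  by (rule poly_eqI) (simp add: coeff_map_poly)

lemma of_real_poly_mult: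
  "map_poly complex_of_real (p * q) = map_poly complex_of_real p * map_poly complex_of_real q"
  by (rule poly_eqI) (simp add: coeff_map_poly coeff_mult)

lemma degree_le_one_coeffs: "degree (p :: 'a::zero poly) \<le> 1 \<Longrightarrow> \<exists>r s. p = [:r, s:]"
  by (cases p) (metis One_nat_def degree_eq_zeroE degree_pCons_eq_if degree_pCons_0 le_SucE le_zero_eq nat.inject pCons_0_0)

lemma poly_tendsto_at: "(poly (Q :: real poly) \<longlongrightarrow> poly Q r) (at r within S)"
  by (intro isCont_tendsto_compose[of r "poly Q" "\<lambda>x. x", simplified] tendsto_ident_at)

lemma poly_nonneg_at_right:
  assumes "\<And>x :: real. x > r \<Longrightarrow> poly Q x \<ge> 0"
  shows "poly Q r \<ge> 0"
  by (rule tendsto_lowerbound[OF poly_tendsto_at[where S = "{r<..}"]])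
     (use assms in \<open>auto simp: eventually_at_right_less intro!: eventually_at_rightI[of r "r + 1"]\<close>)

lemma poly_nonpos_at_left:
  assumes "s < r" "\<And>x :: real. s < x \<Longrightarrow> x < r \<Longrightarrow> poly Q x \<le> 0"
  shows "poly Q r \<le> 0"
  by (rule tendsto_upperbound[OF poly_tendsto_at[where S = "{..<r}"]])
     (use assms in \<open>auto intro!: eventually_at_leftI[of s r]\<close>)

text \<open>Split off a complex root. A root \<open>r \<le> 0\<close> leaves the factor
  \<open>X - r\<close>, which is \<open>X * 1^2\<close> plus the square of
  \<open>sqrt (- r)\<close>; a positive root is at least double and leaves a square; a nonreal root
  leaves a sum of two squares. Degree bounds add under products, so the total stays at
  \<open>degree P\<close>.\<close>

theorem nonneg_poly_stieltjes_sos: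
  assumes "\<And>x. x \<ge> 0 \<Longrightarrow> poly P x \<ge> 0"
  shows "stieltjes_sos (degree P) P"
  using assms
proof (induction "degree P" arbitrary: P rule: less_induct)
  case less
  show ?case
  proof (cases "degree P = 0")
    case True
    then obtain c where c: "P = [:c:]" by (rule degree_eq_zeroE)
    have "c \<ge> 0" using less.prems[of 0] c by simp
    then have "P = [:sqrt c:]\<^sup>2" by (simp add: c power2_eq_square)
    then show ?thesis using stieltjes_sos_square[of "[:sqrt c:]" 0] True by simp
  next
    case False
    define Pc where "Pc = map_poly complex_of_real P"
    have "degree Pc = degree P" by (simp add: Pc_def)
    then have "\<not> constant (poly Pc)" using False by (simp add: constant_degree)
    then obtain z where z: "poly Pc z = 0" using fundamental_theorem_of_algebra by blast
    show ?thesis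
    proof (cases "Im z = 0")
      case True
      define r where "r = Re z"
      have "z = of_real r" using True by (simp add: r_def complex_eq_iff)
      then have "poly P r = 0" using z by (simp add: Pc_def)
      then obtain Q where Q: "P = [:- r, 1:] * Q" using poly_eq_0_iff_dvd by (metis dvdE)
      have Q0: "Q \<noteq> 0" using Q False by auto
      have dQ: "degree P = degree Q + 1" using Q0 unfolding Q by (subst degree_mult_eq) auto
      have PQ: "poly P x = (x - r) * poly Q x" for x by (simp add: Q algebra_simps)
      show ?thesis
      proof (cases "r \<le> 0")
        case r: True
        have Qpos: "poly Q x \<ge> 0" if "x > 0" for x
        proof -
          have "0 \<le> (x - r) * poly Q x" using less.prems[of x] PQ that by simp
          then show ?thesis using that r by (simp add: zero_le_mult_iff)
        qed
        have "poly Q x \<ge> 0" if "x \<ge> 0" for x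
          using Qpos poly_nonneg_at_right[of 0 Q] that by (cases "x = 0") auto
        then have "stieltjes_sos (degree Q) Q" using less.hyps[of Q] dQ by simp
        moreover have "stieltjes_sos 1 [:- r, 1:]"
        proof -
          have "[:- r, 1:] = [:sqrt (- r):]\<^sup>2 + [:0, 1:] * 1\<^sup>2"
            using r by (simp add: power2_eq_square)
          moreover have "stieltjes_sos 1 ([:sqrt (- r):]\<^sup>2 + [:0, 1:] * 1\<^sup>2)"
            by (intro stieltjes_sos.add_X_square stieltjes_sos_square) auto
          ultimately show ?thesis by simp
        qed
        ultimately have "stieltjes_sos (degree Q + 1) (Q * [:- r, 1:])"
          by (intro stieltjes_sos_mult)
        then show ?thesis using dQ Q by (simp add: mult.commute)
      next
        case r: False
        have Qr: "poly Q x \<ge> 0" if "x > r" for x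
        proof -
          have "0 \<le> (x - r) * poly Q x" using less.prems[of x] PQ that r by simp
          then show ?thesis using that by (simp add: zero_le_mult_iff)
        qed
        have Ql: "poly Q x \<le> 0" if "0 \<le> x" "x < r" for x
        proof -
          have "0 \<le> (x - r) * poly Q x" using less.prems[of x] PQ that r by simp
          then show ?thesis using that by (simp add: zero_le_mult_iff)
        qed
        \<comment> \<open>\<open>Q\<close> is nonnegative to the right of \<open>r\<close> and
          nonpositive to the left, so \<open>r\<close> is a root of \<open>Q\<close> too.\<close>
        have "poly Q r = 0"
          using poly_nonneg_at_right[of r Q] poly_nonpos_at_left[of 0 r Q] Qr Ql r by force
        then obtain T where T: "Q = [:- r, 1:] * T" using poly_eq_0_iff_dvd by (metis dvdE)
        have T0: "T \<noteq> 0" using T Q0 by auto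
        have dT: "degree P = degree T + 2" using T0 dQ unfolding T by (subst (asm) degree_mult_eq) auto
        have QT: "poly Q x = (x - r) * poly T x" for x by (simp add: T algebra_simps)
        have Tr: "poly T x \<ge> 0" if "x > r" for x
          using Qr[of x] that by (simp add: QT zero_le_mult_iff)
        have Tl: "poly T x \<ge> 0" if "0 \<le> x" "x < r" for x
          using Ql[of x] that by (simp add: QT mult_le_0_iff)
        have "poly T x \<ge> 0" if "x \<ge> 0" for x
          using Tr Tl poly_nonneg_at_right[of r T] that by (cases x r rule: linorder_cases) auto
        then have "stieltjes_sos (degree T) T" using less.hyps[of T] dT by simp
        moreover have "stieltjes_sos 2 ([:- r, 1:]\<^sup>2)"
          by (intro stieltjes_sos_square) auto
        ultimately have "stieltjes_sos (degree T + 2) (T * [:- r, 1:]\<^sup>2)"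
          by (intro stieltjes_sos_mult)
        moreover have "P = T * [:- r, 1:]\<^sup>2"
          unfolding Q T power2_eq_square by (simp only: mult_ac)
        ultimately show ?thesis using dT by simp
      qed
    next
      case False
      define a b where "a = Re z" and "b = Im z"
      define D where "D = [:- a, 1:]\<^sup>2 + [:b:]\<^sup>2"
      have D: "D = [:a * a + b * b, - 2 * a, 1:]" by (simp add: D_def power2_eq_square)
      have dD: "degree D = 2" by (simp add: D)
      have z': "z = Complex a b" by (simp add: a_def b_def)
      have Dz: "poly (map_poly complex_of_real D) z = 0"
        by (simp add: D z' map_poly_pCons complex_eq_iff algebra_simps)
      define Q R where "Q = P div D" and "R = P mod D"
      have P: "P = Q * D + R" by (simp add: Q_def R_def)
      have "poly Pc z = poly (map_poly complex_of_real Q) z * poly (map_poly complex_of_real D) z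
         + poly (map_poly complex_of_real R) z"
        unfolding Pc_def by (subst P)
          (simp only: of_real_poly_add of_real_poly_mult poly_add poly_mult)
      then have Rz: "poly (map_poly complex_of_real R) z = 0" using z Dz by simp
      have "D \<noteq> 0" using dD by auto
      then have "R = 0 \<or> degree R < 2" using degree_mod_less[of D P] dD by (simp add: R_def)
      then have "degree R \<le> 1" by auto
      then obtain r s where R: "R = [:r, s:]" by (metis degree_le_one_coeffs)
      \<comment> \<open>The remainder is real and at most linear; having the nonreal root
        \<open>z\<close> makes it zero.\<close>
      have "b * s = 0" "r + a * s = 0"
        using Rz by (auto simp: R z' Polynomial.map_poly_pCons[of complex_of_real, OF of_real_0] complex_eq_iff algebra_simps)
      then have "R = 0" using False by (auto simp: R b_def)
      then have PQ: "P = Q * D" using P by simp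
      have Q0: "Q \<noteq> 0" using PQ \<open>degree P \<noteq> 0\<close> by auto
      have dQ: "degree P = degree Q + 2" using PQ Q0 dD \<open>D \<noteq> 0\<close> by (simp add: degree_mult_eq)
      have "poly Q x \<ge> 0" if "x \<ge> 0" for x
      proof -
        have "poly D x = (x - a)\<^sup>2 + b\<^sup>2" by (simp add: D power2_eq_square algebra_simps)
        also have "\<dots> > 0" using False by (intro add_nonneg_pos) (auto simp: b_def)
        finally have "poly D x > 0" .
        moreover have "0 \<le> poly Q x * poly D x" using less.prems[OF that] PQ by simp
        ultimately show ?thesis by (simp add: zero_le_mult_iff)
      qed
      then have "stieltjes_sos (degree Q) Q" using less.hyps[of Q] dQ by simp
      moreover have "stieltjes_sos 2 D"
        unfolding D_def by (intro stieltjes_sos.add_square stieltjes_sos_square) auto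
      ultimately show ?thesis using stieltjes_sos_mult dQ PQ by metis
    qed
  qed
qed

section \<open>Duality with the kernels of the integral representation\<close>

lemma node_prod_insert:
  assumes "finite S" "z \<notin> S" "x \<in> S"
  shows "node_prod (insert z S) x = (x - z) * node_prod S x"
proof -
  have "insert z S - {x} = insert z (S - {x})" using assms by auto
  then show ?thesis using assms by (simp add: node_prod_def)
qed

lemma node_prod_Un_disjoint:
  assumes "finite A" "finite B" "A \<inter> B = {}" "x \<in> A"
  shows "node_prod (A \<union> B) x = node_prod A x * (\<Prod>y\<in>B. x - y)"
proof -
  have "A \<union> B - {x} = (A - {x}) \<union> B" "(A - {x}) \<inter> B = {}" using assms by auto
  then show ?thesis using assms by (simp add: node_prod_def prod.union_disjoint)
qed

text \<open>In the sorted list of nodes, the entries of even index and those of odd index interlace,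
  so every even number of positive nodes fits the locale \<open>interlacing\<close>.\<close>

theorem operator_monotone_divided_difference_nonneg:
  fixes S :: "real set"
  assumes f: "operator_monotone f" and S: "finite S" "card S = 2 * n" "\<And>x. x \<in> S \<Longrightarrow> 0 < x"
    and p: "degree p < n"
  shows "0 \<le> (\<Sum>x\<in>S. f x * (poly p x)\<^sup>2 / node_prod S x)"
proof -
  define xs where "xs = sorted_list_of_set S"
  have xs: "set xs = S" "length xs = 2 * n" "sorted_wrt (<) xs"
    using S by (simp_all add: xs_def)
  have lt: "xs ! i < xs ! j" if "i < j" "j < 2 * n" for i j
    using that xs by (simp add: sorted_wrt_nth_less)
  define a b where "a i = xs ! (2 * i)" and "b i = xs ! (2 * i + 1)" for i
  interpret interlacing n a b
    by standard (auto simp: a_def b_def intro!: lt)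
  have mem: "a i \<in> S" "b i \<in> S" if "i < n" for i
    using that xs(2) unfolding a_def b_def xs(1)[symmetric] by auto
  have "S \<subseteq> SA \<union> SB"
  proof
    fix x assume "x \<in> S"
    then obtain k where k: "k < 2 * n" "x = xs ! k" using xs by (metis in_set_conv_nth)
    show "x \<in> SA \<union> SB"
    proof (cases "even k")
      case True
      then have "x = a (k div 2)" using k by (simp add: a_def)
      then show ?thesis using k by auto
    next
      case False
      then have "x = b (k div 2)" using k by (simp add: b_def)
      then show ?thesis using k by auto
    qed
  qed
  then have SU: "S = SA \<union> SB" using mem by auto
  have "0 \<le> (\<Sum>x\<in>SA. f x * (poly p x)\<^sup>2 / (node_prod SA x * (\<Prod>y\<in>SB. x - y)))
            + (\<Sum>x\<in>SB. f x * (poly p x)\<^sup>2 / (node_prod SB x * (\<Prod>y\<in>SA. x - y)))"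
    using f p mem S(3) by (intro operator_monotone_divided_difference) auto
  also have "(\<Sum>x\<in>SA. f x * (poly p x)\<^sup>2 / (node_prod SA x * (\<Prod>y\<in>SB. x - y)))
     = (\<Sum>x\<in>SA. f x * (poly p x)\<^sup>2 / node_prod S x)"
    unfolding SU using disjoint by (intro sum.cong refl) (simp add: node_prod_Un_disjoint)
  also have "(\<Sum>x\<in>SB. f x * (poly p x)\<^sup>2 / (node_prod SB x * (\<Prod>y\<in>SA. x - y)))
     = (\<Sum>x\<in>SB. f x * (poly p x)\<^sup>2 / node_prod S x)"
    unfolding SU Un_commute[of SA]
    using disjoint by (intro sum.cong refl) (simp add: node_prod_Un_disjoint Int_commute)
  also have "(\<Sum>x\<in>SA. f x * (poly p x)\<^sup>2 / node_prod S x) + (\<Sum>x\<in>SB. f x * (poly p x)\<^sup>2 / node_prod S x)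
     = (\<Sum>x\<in>S. f x * (poly p x)\<^sup>2 / node_prod S x)"
    unfolding SU using disjoint by (intro sum.union_disjoint[symmetric]) auto
  finally show ?thesis .
qed

text \<open>Adding a node \<open>R\<close> at which the polynomial vanishes and letting \<open>R \<rightarrow> \<infinity>\<close>
  trades the even number of nodes for an odd one and reverses the sign.\<close>

lemma operator_monotone_odd_divided_difference:
  fixes T :: "real set"
  assumes f: "operator_monotone f" and T: "finite T" "card T = 2 * n + 1" "\<And>x. x \<in> T \<Longrightarrow> 0 < x"
    and p: "degree p < n"
  shows "(\<Sum>x\<in>T. f x * (poly p x)\<^sup>2 / node_prod T x) \<le> 0"
proof (rule ccontr)
  define g where "g x = f x * (poly p x)\<^sup>2 / node_prod T x" for x
  define \<beta> where "\<beta> = (\<Sum>x\<in>T. g x)"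
  define \<alpha> where "\<alpha> = (\<Sum>x\<in>T. g x * x)"
  assume "\<not> ?thesis"
  then have \<beta>: "\<beta> > 0" by (simp add: \<beta>_def g_def)
  \<comment> \<open>The inequality derived below is linear in \<open>R\<close>, namely
    \<open>R * \<beta> \<le> \<alpha>\<close> with \<open>\<beta> > 0\<close>. The second entry of
    the maximum violates it; the first keeps \<open>R\<close> beyond all nodes.\<close>
  define R where "R = max (Max T + 1) ((\<alpha> + 1) / \<beta>)"
  have "T \<noteq> {}" using T by auto
  have RT: "x < R" if "x \<in> T" for x
    using Max_ge[OF T(1) that] by (simp add: R_def)
  then have R: "R \<notin> T" by auto
  have "R > 0" using RT T(3) \<open>T \<noteq> {}\<close> by (meson all_not_in_conv less_trans)
  have "degree ([:- R, 1:] * p) < n + 1"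
    using degree_mult_le[of "[:- R, 1:]" p] p by (simp del: mult_pCons_left)
  then have "0 \<le> (\<Sum>x\<in>insert R T. f x * (poly ([:- R, 1:] * p) x)\<^sup>2 / node_prod (insert R T) x)"
    using f T R \<open>R > 0\<close>
    by (intro operator_monotone_divided_difference_nonneg[where n = "n + 1"]) auto
  also have "\<dots> = (\<Sum>x\<in>T. f x * (poly ([:- R, 1:] * p) x)\<^sup>2 / node_prod (insert R T) x)"
    using T R by simp
  also have "\<dots> = (\<Sum>x\<in>T. g x * x - R * g x)"
  proof (intro sum.cong refl)
    fix x assume x: "x \<in> T"
    then have "x - R \<noteq> 0" using R by auto
    then have "(x - R) * (x - R) / ((x - R) * node_prod T x) = (x - R) / node_prod T x" by simp
    then have "f x * (poly p x)\<^sup>2 * ((x - R) * (x - R) / ((x - R) * node_prod T x)) = (x - R) * g x"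
      by (simp add: g_def)
    moreover have "poly ([:- R, 1:] * p) x = (x - R) * poly p x" by (simp add: algebra_simps)
    ultimately show "f x * (poly ([:- R, 1:] * p) x)\<^sup>2 / node_prod (insert R T) x = g x * x - R * g x"
      unfolding node_prod_insert[OF T(1) R x]
      by (simp add: power_mult_distrib power2_eq_square algebra_simps)
  qed
  also have "\<dots> = \<alpha> - R * \<beta>" by (simp add: \<alpha>_def \<beta>_def sum_subtractf sum_distrib_left)
  finally have "R * \<beta> \<le> \<alpha>" by simp
  moreover have "(\<alpha> + 1) / \<beta> * \<beta> \<le> R * \<beta>" using \<beta> by (intro mult_right_mono) (auto simp: R_def)
  ultimately show False using \<beta> by simp
qed

theorem operator_monotone_divided_difference_nonpos:
  fixes S :: "real set"
  assumes f: "operator_monotone f" "\<And>x. 0 < x \<Longrightarrow> 0 < f x"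
    and S: "finite S" "card S = 2 * n" "\<And>x. x \<in> S \<Longrightarrow> 0 < x"
    and p: "degree p < n"
  shows "(\<Sum>x\<in>S. f x * (poly p x)\<^sup>2 / (x * node_prod S x)) \<le> 0"
proof -
  have "S \<noteq> {}" using S p by auto
  define m where "m = Min S"
  have m: "m > 0" "\<And>x. x \<in> S \<Longrightarrow> m \<le> x" using S \<open>S \<noteq> {}\<close> by (auto simp: m_def)
  have *: "(\<Sum>x\<in>S. f x * (poly p x)\<^sup>2 / ((x - \<epsilon>) * node_prod S x)) \<le> 0" if \<epsilon>: "0 < \<epsilon>" "\<epsilon> < m" for \<epsilon>
  proof -
    have \<epsilon>S: "\<epsilon> \<notin> S" using m \<epsilon> by fastforce
    have "(\<Sum>x\<in>insert \<epsilon> S. f x * (poly p x)\<^sup>2 / node_prod (insert \<epsilon> S) x) \<le> 0"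
      using f S p \<epsilon> \<epsilon>S by (intro operator_monotone_odd_divided_difference[where n = n]) auto
    then have le: "f \<epsilon> * (poly p \<epsilon>)\<^sup>2 / node_prod (insert \<epsilon> S) \<epsilon>
       + (\<Sum>x\<in>S. f x * (poly p x)\<^sup>2 / node_prod (insert \<epsilon> S) x) \<le> 0"
      using S \<epsilon>S by simp
    \<comment> \<open>Every factor \<open>\<epsilon> - y\<close> is negative, but their number is
      even.\<close>
    have "node_prod (insert \<epsilon> S) \<epsilon> = (\<Prod>y\<in>S. - 1 * (y - \<epsilon>))"
      using \<epsilon>S by (simp add: node_prod_def)
    also have "\<dots> = (\<Prod>y\<in>S. y - \<epsilon>)"
      unfolding prod.distrib using S by simp
    also have "\<dots> \<ge> 0" using m \<epsilon> by (intro prod_nonneg) fastforce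
    finally have "0 \<le> f \<epsilon> * (poly p \<epsilon>)\<^sup>2 / node_prod (insert \<epsilon> S) \<epsilon>"
      using f(2)[of \<epsilon>] \<epsilon> by simp
    moreover have "(\<Sum>x\<in>S. f x * (poly p x)\<^sup>2 / node_prod (insert \<epsilon> S) x)
      = (\<Sum>x\<in>S. f x * (poly p x)\<^sup>2 / ((x - \<epsilon>) * node_prod S x))"
      using S \<epsilon>S by (intro sum.cong refl) (simp add: node_prod_insert)
    ultimately show ?thesis using le by linarith
  qed
  have "((\<lambda>\<epsilon>. \<Sum>x\<in>S. f x * (poly p x)\<^sup>2 / ((x - \<epsilon>) * node_prod S x)) \<longlongrightarrow>
      (\<Sum>x\<in>S. f x * (poly p x)\<^sup>2 / ((x - 0) * node_prod S x))) (at_right 0)"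
    using S node_prod_nonzero[OF S(1)] by (intro tendsto_intros) fastforce+
  then have "(\<Sum>x\<in>S. f x * (poly p x)\<^sup>2 / ((x - 0) * node_prod S x)) \<le> 0"
    by (rule tendsto_upperbound) (use * m in \<open>auto intro!: eventually_at_rightI[of 0 m]\<close>)
  then show ?thesis by simp
qed

text \<open>\<open>P\<close> is the numerator of the combination over its common denominator, and
  \<open>L P\<close> is minus the sum to be bounded. \<open>L\<close> is nonpositive on both kinds
  of summands of \<open>P\<close>: on squares by the inequality for \<open>f(x) / x\<close>, and on
  \<open>X b^2\<close> because the factor \<open>- x\<close> cancels the denominator and reverses
  the inequality for \<open>f\<close>.\<close>

lemma operator_monotone_duality_even:
  fixes S :: "real set"
  assumes f: "operator_monotone f" "\<And>x. 0 < x \<Longrightarrow> 0 < f x"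
    and S: "finite S" "card S = 2 * n" "\<And>x. x \<in> S \<Longrightarrow> 0 < x"
    and c: "\<And>t. 0 \<le> t \<Longrightarrow> 0 \<le> (\<Sum>x\<in>S. c x * (x / (x + t)))"
  shows "0 \<le> (\<Sum>x\<in>S. c x * f x)"
proof (cases "n = 0")
  case True
  then show ?thesis using S by simp
next
  case False
  define P where "P = (\<Sum>x\<in>S. Polynomial.smult (c x * x) (\<Prod>y\<in>S - {x}. [:y, 1:]))"
  \<comment> \<open>Evaluation at \<open>- x\<close> isolates the coefficient \<open>c x\<close>,
    since all other summands of \<open>P\<close> contain the factor \<open>X + x\<close>.\<close>
  define L where "L Q = (\<Sum>x\<in>S. f x * poly Q (- x) / (x * node_prod S x))" for Q
  have "degree (\<Prod>y\<in>S - {x}. [:y, 1:]) = 2 * n - 1" if "x \<in> S" for x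
    using that S by (subst degree_prod_eq_sum_degree) auto
  then have degP: "degree P \<le> 2 * n - 1"
    unfolding P_def using S(1) by (intro degree_sum_le order_trans[OF degree_smult_le]) auto
  have "poly P t \<ge> 0" if t: "t \<ge> 0" for t
  proof -
    have "poly P t = (\<Prod>y\<in>S. y + t) * (\<Sum>x\<in>S. c x * (x / (x + t)))"
      unfolding P_def poly_sum sum_distrib_left
    proof (intro sum.cong refl)
      fix x assume x: "x \<in> S"
      then have "x + t \<noteq> 0" using S(3)[of x] t by auto
      moreover have "(\<Prod>y\<in>S. y + t) = (x + t) * (\<Prod>y\<in>S - {x}. y + t)"
        using x S by (simp add: prod.remove)
      ultimately show "poly (Polynomial.smult (c x * x) (\<Prod>y\<in>S - {x}. [:y, 1:])) t
          = (\<Prod>y\<in>S. y + t) * (c x * (x / (x + t)))"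
        by (simp add: poly_prod)
    qed
    moreover have "(\<Prod>y\<in>S. y + t) \<ge> 0" using S(3) t by (intro prod_nonneg) fastforce
    ultimately show ?thesis using c[OF t] by simp
  qed
  then have "stieltjes_sos (degree P) P" by (rule nonneg_poly_stieltjes_sos)
  then have "stieltjes_sos (2 * n - 1) P" using degP by (rule stieltjes_sos_mono)
  then have "L P \<le> 0"
  proof (induction rule: stieltjes_sos.induct)
    case zero
    then show ?case by (simp add: L_def)
  next
    case (add_square Q a)
    \<comment> \<open>The odd bound \<open>2 * n - 1\<close> serves both cases:
      \<open>2 * degree a\<close> and \<open>2 * degree b + 1\<close> below it force degrees less
      than \<open>n\<close>.\<close>
    have "degree (pcompose a [:0, - 1:]) < n"
      using add_square.hyps False by (simp add: degree_pcompose)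
    then have "(\<Sum>x\<in>S. f x * (poly (pcompose a [:0, - 1:]) x)\<^sup>2 / (x * node_prod S x)) \<le> 0"
      using f S by (intro operator_monotone_divided_difference_nonpos[where n = n]) auto
    moreover have "L (Q + a\<^sup>2) = L Q +
        (\<Sum>x\<in>S. f x * (poly (pcompose a [:0, - 1:]) x)\<^sup>2 / (x * node_prod S x))"
      by (simp add: L_def poly_pcompose ring_distribs add_divide_distrib sum.distrib)
    ultimately show ?case using add_square.IH by simp
  next
    case (add_X_square Q b)
    have "degree (pcompose b [:0, - 1:]) < n"
      using add_X_square.hyps False by (simp add: degree_pcompose)
    then have "0 \<le> (\<Sum>x\<in>S. f x * (poly (pcompose b [:0, - 1:]) x)\<^sup>2 / node_prod S x)"
      using f S by (intro operator_monotone_divided_difference_nonneg[where n = n]) auto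
    moreover have "L (Q + [:0, 1:] * b\<^sup>2) = L Q -
        (\<Sum>x\<in>S. f x * (poly (pcompose b [:0, - 1:]) x)\<^sup>2 / node_prod S x)"
      unfolding L_def sum_subtractf[symmetric]
    proof (intro sum.cong refl)
      fix x assume "x \<in> S"
      then have "x \<noteq> 0" using S by force
      then show "f x * poly (Q + [:0, 1:] * b\<^sup>2) (- x) / (x * node_prod S x)
        = f x * poly Q (- x) / (x * node_prod S x)
          - f x * (poly (pcompose b [:0, - 1:]) x)\<^sup>2 / node_prod S x"
        by (simp add: poly_pcompose ring_distribs add_divide_distrib diff_divide_distrib)
    qed
    ultimately show ?case using add_X_square.IH by simp
  qed
  also have "L P = - (\<Sum>x\<in>S. c x * f x)"
    unfolding L_def sum_negf[symmetric]
  proof (intro sum.cong refl)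
    fix x assume x: "x \<in> S"
    have "poly P (- x) = (\<Sum>z\<in>S. if z = x then c x * x * (\<Prod>y\<in>S - {x}. y - x) else 0)"
      unfolding P_def poly_sum
    proof (intro sum.cong refl)
      fix z assume z: "z \<in> S"
      have "z \<noteq> x \<Longrightarrow> (\<Prod>y\<in>S - {z}. y - x) = 0" using x S by (auto intro!: prod_zero)
      then show "poly (Polynomial.smult (c z * z) (\<Prod>y\<in>S - {z}. [:y, 1:])) (- x)
          = (if z = x then c x * x * (\<Prod>y\<in>S - {x}. y - x) else 0)"
        by (auto simp: poly_prod)
    qed
    also have "\<dots> = c x * x * (\<Prod>y\<in>S - {x}. y - x)" using x S by simp
    \<comment> \<open>There are \<open>2 * n - 1\<close> factors, so reversing all differences costs
      one sign.\<close>
    also have "(\<Prod>y\<in>S - {x}. y - x) = (\<Prod>y\<in>S - {x}. - 1 * (x - y))" by simp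
    also have "\<dots> = - node_prod S x"
      unfolding prod.distrib using x S False by (simp add: node_prod_def)
    finally have "poly P (- x) = - (c x * x * node_prod S x)" by simp
    moreover have "x \<noteq> 0" using x S by force
    ultimately show "f x * poly P (- x) / (x * node_prod S x) = - (c x * f x)"
      using node_prod_nonzero[OF S(1), of x] by simp
  qed
  finally show ?thesis by simp
qed

text \<open>The substitution \<open>s = t / (1 + t)\<close> turns \<open>kern s x\<close> into \<open>(1 + t) x / (x + t)\<close>.\<close>

definition kern :: "real \<Rightarrow> real \<Rightarrow> real" where
  "kern s x = inverse ((1 - s) + s * inverse x)"

theorem operator_monotone_duality:
  fixes S :: "real set"
  assumes f: "operator_monotone f" "\<And>x. 0 < x \<Longrightarrow> 0 < f x"
    and S: "finite S" "\<And>x. x \<in> S \<Longrightarrow> 0 < x"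
    and c: "\<And>s. 0 \<le> s \<Longrightarrow> s \<le> 1 \<Longrightarrow> 0 \<le> (\<Sum>x\<in>S. c x * kern s x)"
  shows "0 \<le> (\<Sum>x\<in>S. c x * f x)"
proof -
  have ct: "0 \<le> (\<Sum>x\<in>S. c x * (x / (x + t)))" if t: "0 \<le> t" for t
  proof -
    have "0 \<le> (\<Sum>x\<in>S. c x * kern (t / (1 + t)) x)" using t by (intro c) auto
    also have "\<dots> = (1 + t) * (\<Sum>x\<in>S. c x * (x / (x + t)))"
      unfolding sum_distrib_left
    proof (intro sum.cong refl)
      fix x assume "x \<in> S"
      then have x: "x > 0" by (rule S)
      have "1 - t / (1 + t) = 1 / (1 + t)" using t by (simp add: field_simps)
      then have "(1 - t / (1 + t)) + t / (1 + t) * inverse x = (x + t) / ((1 + t) * x)"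
        using t x by (simp add: divide_simps)
      then have "kern (t / (1 + t)) x = (1 + t) * (x / (x + t))"
        by (simp add: kern_def)
      then show "c x * kern (t / (1 + t)) x = (1 + t) * (c x * (x / (x + t)))" by simp
    qed
    finally show ?thesis using t by (simp add: zero_le_mult_iff)
  qed
  show ?thesis
  proof (cases "even (card S)")
    case True
    then obtain n where n: "card S = 2 * n" by (elim evenE)
    show ?thesis by (rule operator_monotone_duality_even[OF f S(1) n S(2) ct])
  next
    case False
    then obtain n where n: "card S = 2 * n + 1" by (elim oddE)
    then have "S \<noteq> {}" by auto
    \<comment> \<open>An extra node with coefficient zero makes the number of nodes even and changes
      no sum.\<close>
    define z where "z = Max S + 1"
    have "x < z" if "x \<in> S" for x using Max_ge[OF S(1) that] by (simp add: z_def)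
    then have "z \<notin> S" by blast
    have "0 < Max S" using S \<open>S \<noteq> {}\<close> by simp
    then have "0 < z" by (simp add: z_def)
    note z = \<open>z \<notin> S\<close> \<open>0 < z\<close>
    define c' where "c' x = (if x \<in> S then c x else 0)" for x
    have eq: "(\<Sum>x\<in>insert z S. c' x * g x) = (\<Sum>x\<in>S. c x * g x)" for g
      using z S by (simp add: c'_def)
    have "0 \<le> (\<Sum>x\<in>insert z S. c' x * f x)"
    proof (rule operator_monotone_duality_even[OF f])
      show "finite (insert z S)" "card (insert z S) = 2 * (n + 1)"
        using S(1) z(1) n by simp_all
      show "0 < x" if "x \<in> insert z S" for x using that S(2) z(2) by blast
      show "0 \<le> (\<Sum>x\<in>insert z S. c' x * (x / (x + t)))" if "0 \<le> t" for t
        unfolding eq using that by (rule ct)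
    qed
    then show ?thesis unfolding eq .
  qed
qed

section \<open>Existence of the representing measure\<close>

lemma kern_pos: "0 \<le> (s :: real) \<Longrightarrow> s \<le> 1 \<Longrightarrow> 0 < x \<Longrightarrow> 0 < (1 - s) + s * inverse x"
  by (cases "s = 0") (auto intro!: add_nonneg_pos mult_pos_pos)

lemma kern_nonneg: "0 \<le> s \<Longrightarrow> s \<le> 1 \<Longrightarrow> 0 < x \<Longrightarrow> 0 \<le> kern s x"
  using kern_pos[of s x] by (simp add: kern_def)

text \<open>\<open>kern s x\<close> is the harmonic mean of 1 and \<open>x\<close> with weights
  \<open>1 - s\<close> and \<open>s\<close>.\<close>

lemma kern_le_max:
  assumes "0 \<le> s" "s \<le> 1" "0 < x"
  shows "kern s x \<le> max 1 x"
proof -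
  have "(1 - s) * inverse (max 1 x) \<le> (1 - s) * 1"
    using assms by (intro mult_left_mono inverse_le_1_iff[THEN iffD2]) auto
  moreover have "s * inverse (max 1 x) \<le> s * inverse x"
    using assms by (intro mult_left_mono le_imp_inverse_le) auto
  ultimately have "inverse (max 1 x) \<le> (1 - s) + s * inverse x"
    by (simp add: algebra_simps)
  then have "inverse ((1 - s) + s * inverse x) \<le> inverse (inverse (max 1 x))"
    using assms by (intro le_imp_inverse_le) auto
  then show ?thesis by (simp add: kern_def)
qed

lemma kern_one [simp]: "kern s 1 = 1"
  by (simp add: kern_def)

lemma kern_mono:
  assumes "0 \<le> s" "s \<le> 1" "0 < x" "x \<le> y"
  shows "kern s x \<le> kern s y"
  unfolding kern_def using assms kern_pos[of s y]
  by (intro le_imp_inverse_le add_left_mono mult_left_mono) auto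

text \<open>\<open>c * kern s x\<close> is the weighted harmonic mean of \<open>c\<close> and
  \<open>c * x\<close>, whereas the left-hand side averages 1 and \<open>c * x\<close>.\<close>

lemma kern_scale_le:
  assumes "0 \<le> s" "s \<le> 1" "0 < x" "1 \<le> c"
  shows "kern s (c * x) \<le> c * kern s x"
proof -
  have "(1 - s) * inverse c \<le> (1 - s) * 1"
    using assms by (intro mult_left_mono inverse_le_1_iff[THEN iffD2]) auto
  then have "inverse c * ((1 - s) + s * inverse x) \<le> (1 - s) + s * inverse (c * x)"
    using assms by (simp add: algebra_simps)
  then have "inverse ((1 - s) + s * inverse (c * x)) \<le> inverse (inverse c * ((1 - s) + s * inverse x))"
    using assms kern_pos[of s x] by (intro le_imp_inverse_le) auto
  then show ?thesis by (simp add: kern_def)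
qed

lemma continuous_on_kern: "0 < x \<Longrightarrow> continuous_on {0..1} (\<lambda>s. kern s x)"
  unfolding kern_def
  by (intro continuous_intros ballI) (use kern_pos in \<open>fastforce simp: less_le\<close>)

text \<open>The convex hull of the point masses on the unit interval. Finite support makes every
  expectation a finite sum, so integrability is automatic.\<close>

definition fin_pmfs :: "real pmf set" where
  "fin_pmfs = {p. finite (set_pmf p) \<and> set_pmf p \<subseteq> {0..1}}"

definition kern_mean :: "real pmf \<Rightarrow> real \<Rightarrow> real" where
  "kern_mean p x = measure_pmf.expectation p (\<lambda>s. kern s x)"

lemma kern_mean_bounds:
  assumes "p \<in> fin_pmfs" "0 < x"
  shows "0 \<le> kern_mean p x" "kern_mean p x \<le> max 1 x"
proof -
  have int: "integrable (measure_pmf p) (\<lambda>s. kern s x)"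
    using assms by (intro integrable_measure_pmf_finite) (simp add: fin_pmfs_def)
  have AE: "AE s in measure_pmf p. 0 \<le> s \<and> s \<le> 1"
    using assms by (auto simp: AE_measure_pmf_iff fin_pmfs_def)
  show "0 \<le> kern_mean p x" unfolding kern_mean_def
    by (rule integral_nonneg_AE) (use AE kern_nonneg assms(2) in auto)
  show "kern_mean p x \<le> max 1 x"
    unfolding kern_mean_def
    by (rule measure_pmf.integral_le_const[OF int]) (use AE kern_le_max assms(2) in auto)
qed

lemma mix_in_fin_pmfs:
  assumes p: "p \<in> fin_pmfs" and s: "0 \<le> s" "s \<le> 1" and \<theta>: "0 \<le> \<theta>" "\<theta> \<le> 1"
  defines "p' \<equiv> bind_pmf (bernoulli_pmf \<theta>) (\<lambda>b. if b then return_pmf s else p)"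
  shows "p' \<in> fin_pmfs" "kern_mean p' x = \<theta> * kern s x + (1 - \<theta>) * kern_mean p x"
proof -
  show "p' \<in> fin_pmfs"
    using p s by (auto simp: fin_pmfs_def p'_def split: if_splits)
  have "kern_mean p' x = (\<Sum>b\<in>UNIV. pmf (bernoulli_pmf \<theta>) b *\<^sub>R
      measure_pmf.expectation (if b then return_pmf s else p) (\<lambda>s. kern s x))"
    unfolding kern_mean_def p'_def using p
    by (intro pmf_expectation_bind) (auto simp: fin_pmfs_def)
  then show "kern_mean p' x = \<theta> * kern s x + (1 - \<theta>) * kern_mean p x"
    using \<theta> by (simp add: UNIV_bool kern_mean_def)
qed

locale normalized_operator_monotone =
  fixes f :: "real \<Rightarrow> real"
  assumes mono: "operator_monotone f" and pos: "\<And>x. 0 < x \<Longrightarrow> 0 < f x" and one: "f 1 = 1"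
begin

text \<open>If every \<open>s\<close> failed, the functional with coefficients
  \<open>kern_mean p x - f x\<close>, corrected by a multiple of evaluation at 1, would be
  nonnegative on all kernels. Duality would then make it nonnegative on \<open>f\<close>, where its
  value is minus half the squared error.\<close>

lemma descent_direction:
  assumes p: "p \<in> fin_pmfs" and S: "finite S" "\<And>x. x \<in> S \<Longrightarrow> 0 < x"
    and \<Phi>: "0 < (\<Sum>x\<in>S. (kern_mean p x - f x)\<^sup>2)"
  shows "\<exists>s. 0 \<le> s \<and> s \<le> 1 \<and>
    (\<Sum>x\<in>S. (kern_mean p x - f x) * (kern s x - kern_mean p x)) < - (\<Sum>x\<in>S. (kern_mean p x - f x)\<^sup>2) / 2"
proof (rule ccontr)
  define c where "c x = kern_mean p x - f x" for x
  define \<Phi> where "\<Phi> = (\<Sum>x\<in>S. (c x)\<^sup>2)"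
  \<comment> \<open>Every kernel and \<open>f\<close> take the value 1 at 1, so evaluation there
    acts as a constant. \<open>\<gamma>\<close> is the constant that turns the assumed lower bound
    into nonnegativity; the conditionals in \<open>c'\<close> allow 1 to lie in \<open>S\<close> or
    not.\<close>
  define \<gamma> where "\<gamma> = (\<Sum>x\<in>S. c x * kern_mean p x) - \<Phi> / 2"
  define c' where "c' x = (if x \<in> S then c x else 0) - (if x = 1 then \<gamma> else 0)" for x
  have eq: "(\<Sum>x\<in>insert 1 S. c' x * g x) = (\<Sum>x\<in>S. c x * g x) - \<gamma> * g 1" for g
  proof -
    have "(\<Sum>x\<in>insert 1 S. c' x * g x) = (\<Sum>x\<in>insert 1 S. if x \<in> S then c x * g x else 0)
       - (\<Sum>x\<in>insert 1 S. if x = 1 then \<gamma> * g 1 else 0)"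
      unfolding sum_subtractf[symmetric] by (intro sum.cong refl) (auto simp: c'_def algebra_simps)
    also have "(\<Sum>x\<in>insert 1 S. if x \<in> S then c x * g x else 0) = (\<Sum>x\<in>S. c x * g x)"
      using S(1) by (intro sum.mono_neutral_cong_right) auto
    also have "(\<Sum>x\<in>insert 1 S. if x = 1 then \<gamma> * g 1 else 0) = \<gamma> * g 1"
      using S(1) by simp
    finally show ?thesis .
  qed
  assume "\<not> ?thesis"
  then have *: "- \<Phi> / 2 \<le> (\<Sum>x\<in>S. c x * (kern s x - kern_mean p x))" if "0 \<le> s" "s \<le> 1" for s
    using that by (fastforce simp: c_def \<Phi>_def not_less)
  have "0 \<le> (\<Sum>x\<in>insert 1 S. c' x * f x)"
  proof (rule operator_monotone_duality[OF mono pos])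
    show "finite (insert 1 S)" using S by simp
    show "0 < x" if "x \<in> insert 1 S" for x using that S by auto
    show "0 \<le> (\<Sum>x\<in>insert 1 S. c' x * kern s x)" if "0 \<le> s" "s \<le> 1" for s
      using *[OF that] unfolding eq by (simp add: \<gamma>_def right_diff_distrib sum_subtractf)
  qed
  then have "0 \<le> (\<Sum>x\<in>S. c x * f x) - (\<Sum>x\<in>S. c x * kern_mean p x) + \<Phi> / 2"
    unfolding eq one \<gamma>_def by simp
  also have "(\<Sum>x\<in>S. c x * f x) - (\<Sum>x\<in>S. c x * kern_mean p x) = - \<Phi>"
    unfolding \<Phi>_def sum_subtractf[symmetric] sum_negf[symmetric]
    by (intro sum.cong refl) (simp add: c_def power2_eq_square algebra_simps)
  finally show False using \<open>0 < (\<Sum>x\<in>S. (kern_mean p x - f x)\<^sup>2)\<close> by (simp add: \<Phi>_def c_def)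
qed

text \<open>By convexity, a near-minimiser of the squared error at the nodes admits a descent direction
  towards a point mass unless the error is already small.\<close>

lemma approximate_interpolation:
  assumes S: "finite S" "\<And>x. x \<in> S \<Longrightarrow> 0 < x" and e: "0 < e"
  shows "\<exists>p\<in>fin_pmfs. \<forall>x\<in>S. \<bar>kern_mean p x - f x\<bar> < e"
proof -
  define \<Phi> where "\<Phi> p = (\<Sum>x\<in>S. (kern_mean p x - f x)\<^sup>2)" for p
  define I where "I = Inf (\<Phi> ` fin_pmfs)"
  have ne: "return_pmf 0 \<in> fin_pmfs" by (simp add: fin_pmfs_def)
  have \<Phi>0: "0 \<le> \<Phi> p" for p by (simp add: \<Phi>_def sum_nonneg)
  have bdd: "bdd_below (\<Phi> ` fin_pmfs)" by (rule bdd_belowI[of _ 0]) (use \<Phi>0 in auto)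
  have I_le: "I \<le> \<Phi> p" if "p \<in> fin_pmfs" for p
    unfolding I_def using that bdd by (intro cInf_lower) auto
  have I_approx: "\<exists>p\<in>fin_pmfs. \<Phi> p < I + \<eta>" if "\<eta> > 0" for \<eta>
    using cInf_lessD[of "\<Phi> ` fin_pmfs" "I + \<eta>"] ne that by (auto simp: I_def)
  have I0: "I \<ge> 0" unfolding I_def using ne \<Phi>0 by (intro cInf_greatest) auto
  have "I = 0"
  proof (rule ccontr)
    assume "I \<noteq> 0"
    then have I: "I > 0" using I0 by simp
    define C where "C = (\<Sum>x\<in>S. (max 1 x)\<^sup>2)"
    have C0: "C \<ge> 0" by (simp add: C_def sum_nonneg)
    \<comment> \<open>This gives \<open>\<theta> * C \<le> I / 2\<close>: the quadratic term costs
      at most half of the linear gain \<open>\<theta> * I\<close>, and the other half exceeds the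
      distance of \<open>\<Phi> p\<close> from the infimum.\<close>
    define \<theta> where "\<theta> = I / (2 * (C + I))"
    have \<theta>: "0 < \<theta>" "\<theta> \<le> 1" using I C0 by (simp_all add: \<theta>_def)
    have \<theta>C: "\<theta> * C \<le> I / 2"
      using I C0 by (simp add: \<theta>_def divide_simps)
    obtain p where p: "p \<in> fin_pmfs" "\<Phi> p < I + \<theta> * I / 2"
      using I_approx[of "\<theta> * I / 2"] \<theta> I by auto
    have "\<Phi> p > 0" using I I_le[OF p(1)] by linarith
    then obtain s where s: "0 \<le> s" "s \<le> 1"
      and D: "(\<Sum>x\<in>S. (kern_mean p x - f x) * (kern s x - kern_mean p x)) < - \<Phi> p / 2"
      using descent_direction[OF p(1) S] unfolding \<Phi>_def by blast
    define p' where "p' = bind_pmf (bernoulli_pmf \<theta>) (\<lambda>b. if b then return_pmf s else p)"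
    have p': "p' \<in> fin_pmfs" "\<And>x. kern_mean p' x = \<theta> * kern s x + (1 - \<theta>) * kern_mean p x"
      unfolding p'_def using mix_in_fin_pmfs[OF p(1) s, of \<theta>] \<theta> by auto
    have "\<Phi> p' = (\<Sum>x\<in>S. (kern_mean p x - f x)\<^sup>2
        + 2 * \<theta> * ((kern_mean p x - f x) * (kern s x - kern_mean p x))
        + \<theta>\<^sup>2 * (kern s x - kern_mean p x)\<^sup>2)"
      unfolding \<Phi>_def p'(2) by (intro sum.cong refl) (simp add: power2_eq_square algebra_simps)
    also have "\<dots> = \<Phi> p + 2 * \<theta> * (\<Sum>x\<in>S. (kern_mean p x - f x) * (kern s x - kern_mean p x))
        + \<theta>\<^sup>2 * (\<Sum>x\<in>S. (kern s x - kern_mean p x)\<^sup>2)"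
      by (simp add: sum.distrib sum_distrib_left \<Phi>_def)
    also have "\<dots> \<le> \<Phi> p + 2 * \<theta> * (- \<Phi> p / 2) + \<theta>\<^sup>2 * C"
    proof (intro add_mono mult_left_mono order.refl)
      show "(\<Sum>x\<in>S. (kern s x - kern_mean p x)\<^sup>2) \<le> C"
        unfolding C_def
      proof (intro sum_mono)
        fix x assume "x \<in> S"
        then have x: "0 < x" by (rule S)
        have "\<bar>kern s x - kern_mean p x\<bar> \<le> \<bar>max 1 x\<bar>"
          using kern_mean_bounds[OF p(1) x] kern_nonneg[OF s x] kern_le_max[OF s x] by linarith
        then show "(kern s x - kern_mean p x)\<^sup>2 \<le> (max 1 x)\<^sup>2" by (simp only: abs_le_square_iff)
      qed
    qed (use D \<theta> in auto)
    also have "\<dots> = \<Phi> p - \<theta> * \<Phi> p + \<theta> * (\<theta> * C)" by (simp add: power2_eq_square)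
    also have "\<dots> \<le> \<Phi> p - \<theta> * I + \<theta> * (I / 2)"
      using \<theta> \<theta>C I_le[OF p(1)] by (intro add_mono diff_mono mult_left_mono order.refl) auto
    also have "\<dots> < I" using p(2) by (simp add: field_simps)
    finally show False using I_le[OF p'(1)] by linarith
  qed
  then obtain p where p: "p \<in> fin_pmfs" "\<Phi> p < e\<^sup>2" using I_approx[of "e\<^sup>2"] e by auto
  have "\<bar>kern_mean p x - f x\<bar> < e" if "x \<in> S" for x
  proof -
    have "(kern_mean p x - f x)\<^sup>2 \<le> \<Phi> p"
      unfolding \<Phi>_def using that S(1)
      by (intro member_le_sum[where f = "\<lambda>x. (kern_mean p x - f x)\<^sup>2"]) auto
    then have "\<bar>kern_mean p x - f x\<bar>\<^sup>2 < e\<^sup>2" using p by simp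
    then show ?thesis using e by (simp add: power2_less_imp_less)
  qed
  then show ?thesis using p by blast
qed

lemma mono_on_pos:
  assumes "0 < x" "x \<le> y"
  shows "f x \<le> f y"
proof (cases "x = y")
  case False
  then have lt: "x < y" using assms by simp
  have "0 \<le> (\<Sum>z\<in>{x, y}. f z * (poly 1 z)\<^sup>2 / node_prod {x, y} z)"
    using lt assms mono by (intro operator_monotone_divided_difference_nonneg[where n = 1]) auto
  also have "\<dots> = f x / (x - y) + f y / (y - x)"
  proof -
    have "{x, y} - {x} = {y}" "{x, y} - {y} = {x}" using lt by auto
    then show ?thesis using lt by (simp add: node_prod_def)
  qed
  also have "f x / (x - y) = - f x / (y - x)" by (metis minus_diff_eq minus_divide_divide minus_minus)
  finally have "0 \<le> (f y - f x) / (y - x)" by (simp add: diff_divide_distrib)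
  then show ?thesis using lt by (simp add: zero_le_divide_iff)
qed simp

text \<open>The approximants match \<open>f\<close> ever better at positive rationals, and a weak
  limit matches it at all of them. Irrational points are squeezed, since \<open>f\<close> is
  monotone and the limit satisfies \<open>F (c * x) \<le> c * F x\<close>.\<close>

theorem ex_represents: "\<exists>\<nu>. represents \<nu> f"
proof -
  \<comment> \<open>The weak limit \<open>M\<close> is a law on the whole line. Composing with
    \<open>clamp\<close> makes the kernel a bounded continuous test function there, and at the end
    \<open>clamp\<close> pushes \<open>M\<close> forward to the unit interval.\<close>
  define clamp :: "real \<Rightarrow> real" where "clamp s = max 0 (min 1 s)" for s
  have clamp: "0 \<le> clamp s" "clamp s \<le> 1" for s by (auto simp: clamp_def)
  have clamp_cont: "continuous_on UNIV clamp"
    unfolding clamp_def by (intro continuous_intros)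
  define q where "q = from_nat_into {x::real. 0 < x \<and> x \<in> \<rat>}"
  have "countable {x::real. 0 < x \<and> x \<in> \<rat>}" by (rule countable_subset[OF _ countable_rat]) auto
  moreover have "(1::real) \<in> {x. 0 < x \<and> x \<in> \<rat>}" by simp
  ultimately have q: "range q = {x. 0 < x \<and> x \<in> \<rat>}"
    unfolding q_def by (intro range_from_nat_into) blast+
  have q_pos: "0 < q i" for i using q by auto
  have "\<exists>p\<in>fin_pmfs. \<forall>x\<in>q ` {..k}. \<bar>kern_mean p x - f x\<bar> < 1 / real (Suc k)" for k
    by (rule approximate_interpolation) (use q_pos in auto)
  then obtain p where p: "\<And>k. p k \<in> fin_pmfs"
    and p_close: "\<And>k i. i \<le> k \<Longrightarrow> \<bar>kern_mean (p k) (q i) - f (q i)\<bar> < 1 / real (Suc k)"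
    by (metis atMost_iff imageI)
  define \<mu> where "\<mu> k = distr (measure_pmf (p k)) borel (\<lambda>s. s)" for k
  have rd: "real_distribution (\<mu> k)" for k
    unfolding \<mu>_def by (rule prob_space.real_distribution_distr[OF prob_space_measure_pmf]) simp
  \<comment> \<open>Tightness is phrased with half-open intervals; the left end -1 keeps a possible
    atom at 0 inside.\<close>
  have meas: "measure (\<mu> k) {-1<..1} = 1" for k
  proof -
    have "measure (\<mu> k) {-1<..1} = measure (measure_pmf (p k)) {-1<..1}"
      unfolding \<mu>_def by (subst measure_distr) auto
    also have "\<dots> = 1"
      using p[of k] by (subst measure_pmf.prob_eq_1) (auto simp: AE_measure_pmf_iff fin_pmfs_def intro: less_le_trans[of _ 0])
    finally show ?thesis .
  qed
  have "tight \<mu>" unfolding tight_def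
  proof (intro conjI allI impI)
    fix \<epsilon> :: real assume "\<epsilon> > 0"
    then show "\<exists>a b. a < b \<and> (\<forall>n. 1 - \<epsilon> < measure (\<mu> n) {a<..b})"
      by (intro exI[of _ "-1"] exI[of _ 1]) (simp add: meas)
  qed (rule rd)
  then obtain r M where r: "strict_mono (r :: nat \<Rightarrow> nat)" and M: "real_distribution M"
    and conv: "weak_conv_m (\<mu> \<circ> id \<circ> r) M"
    using tight_imp_convergent_subsubsequence[of \<mu> id] strict_mono_id by blast
  interpret M: real_distribution M by fact
  define F where "F x = (\<integral>s. kern (clamp s) x \<partial>M)" for x
  have kc_cont: "continuous_on UNIV (\<lambda>s. kern (clamp s) x)" if "0 < x" for x
    by (rule continuous_on_compose2[OF continuous_on_kern[OF that] clamp_cont]) (use clamp in auto)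
  have kc_bound: "norm (kern (clamp s) x) \<le> max 1 x" if "0 < x" for x s
    using kern_nonneg[OF clamp that] kern_le_max[OF clamp that] by simp
  have kc_meas: "(\<lambda>s. kern (clamp s) x) \<in> borel_measurable borel" if "0 < x" for x
    by (rule borel_measurable_continuous_onI[OF kc_cont[OF that]])
  have kc_int: "integrable M (\<lambda>s. kern (clamp s) x)" if "0 < x" for x
    by (rule M.integrable_const_bound[where B = "max 1 x"])
       (use kc_bound[OF that] kc_meas[OF that] in auto)
  have Fq: "F (q i) = f (q i)" for i
  proof -
    have "(\<lambda>k. integral\<^sup>L ((\<mu> \<circ> id \<circ> r) k) (\<lambda>s. kern (clamp s) (q i))) \<longlonglongrightarrow> F (q i)"
      unfolding F_def
    proof (rule weak_conv_imp_integral_bdd_continuous_conv[OF _ M conv])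
      show "isCont (\<lambda>s. kern (clamp s) (q i)) x" for x
        using kc_cont[OF q_pos] by (simp add: continuous_on_eq_continuous_at)
    qed (use rd kc_bound[OF q_pos] in auto)
    moreover have "integral\<^sup>L ((\<mu> \<circ> id \<circ> r) k) (\<lambda>s. kern (clamp s) (q i)) = kern_mean (p (r k)) (q i)" for k
    proof -
      have "integral\<^sup>L (\<mu> (r k)) (\<lambda>s. kern (clamp s) (q i))
         = measure_pmf.expectation (p (r k)) (\<lambda>s. kern (clamp s) (q i))"
        unfolding \<mu>_def by (rule integral_distr) (use kc_meas[OF q_pos] in auto)
      also have "\<dots> = kern_mean (p (r k)) (q i)"
        unfolding kern_mean_def
        by (rule integral_cong_AE) (use p[of "r k"] in \<open>auto simp: AE_measure_pmf_iff fin_pmfs_def clamp_def max_def min_def subset_iff\<close>)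
      finally show ?thesis by simp
    qed
    ultimately have lim1: "(\<lambda>k. kern_mean (p (r k)) (q i)) \<longlonglongrightarrow> F (q i)" by simp
    have "(\<lambda>k. kern_mean (p k) (q i) - f (q i)) \<longlonglongrightarrow> 0"
    proof (rule Lim_null_comparison)
      show "\<forall>\<^sub>F k in sequentially. norm (kern_mean (p k) (q i) - f (q i)) \<le> 1 / real (Suc k)"
        using eventually_ge_at_top[of i] by eventually_elim (use p_close in \<open>auto intro: less_imp_le\<close>)
      show "(\<lambda>k. 1 / real (Suc k)) \<longlonglongrightarrow> 0" by (rule LIMSEQ_Suc[OF lim_1_over_n])
    qed
    then have "(\<lambda>k. kern_mean (p k) (q i)) \<longlonglongrightarrow> f (q i)" by (rule LIM_zero_cancel)
    from LIMSEQ_subseq_LIMSEQ[OF this r] have "(\<lambda>k. kern_mean (p (r k)) (q i)) \<longlonglongrightarrow> f (q i)"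
      by (simp add: o_def)
    with lim1 show ?thesis by (rule LIMSEQ_unique)
  qed
  have Frat: "F x = f x" if "x \<in> \<rat>" "0 < x" for x
  proof -
    have "x \<in> range q" using that q by auto
    then show ?thesis using Fq by auto
  qed
  have F_scale: "F (c * x) \<le> c * F x" if "0 < x" "1 \<le> c" for c x
  proof -
    have "F (c * x) \<le> (\<integral>s. c * kern (clamp s) x \<partial>M)"
      unfolding F_def using that kern_scale_le[OF clamp that]
      by (intro integral_mono kc_int integrable_mult_right) auto
    then show ?thesis by (simp add: F_def)
  qed
  have F_nonneg: "0 \<le> F x" if "0 < x" for x
    unfolding F_def using kern_nonneg[OF clamp that] by (intro Bochner_Integration.integral_nonneg) auto
  have Ff: "F x = f x" if x: "0 < x" for x
  proof (rule antisym)
    show "F x \<le> f x"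
    proof (rule field_le_mult_one_interval)
      fix z :: real assume z: "0 < z" "z < 1"
      then have "z * x < x" using x by simp
      \<comment> \<open>Scaling moves \<open>F\<close> from \<open>x\<close> down to the rational
        \<open>y\<close> at the cost \<open>x / y\<close>, which \<open>z\<close> absorbs;
        monotonicity moves \<open>f\<close> back up to \<open>x\<close>.\<close>
      then obtain y where y: "y \<in> \<rat>" "z * x < y" "y < x" using Rats_dense_in_real by blast
      have y0: "0 < y" using y z x by (meson less_trans mult_pos_pos)
      have "z * F x = z * F ((x / y) * y)" using y0 by simp
      also have "\<dots> \<le> z * ((x / y) * F y)"
        using z y y0 x by (intro mult_left_mono F_scale) auto
      also have "\<dots> = (z * x / y) * f y" using Frat[OF y(1) y0] by simp
      also have "\<dots> \<le> 1 * f y"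
        using y y0 pos[OF y0] by (intro mult_right_mono) auto
      also have "\<dots> \<le> f x" using mono_on_pos[OF y0, of x] y by simp
      finally show "z * F x \<le> f x" .
    qed
    show "f x \<le> F x"
    proof (rule field_le_mult_one_interval)
      fix z :: real assume z: "0 < z" "z < 1"
      then have "x < x / z" using x by (simp add: field_simps)
      then obtain y where y: "y \<in> \<rat>" "x < y" "y < x / z" using Rats_dense_in_real by blast
      have y0: "0 < y" using y x by simp
      have "z * f x \<le> z * f y" using z mono_on_pos[OF x, of y] y by simp
      also have "\<dots> = z * F ((y / x) * x)" using Frat[OF y(1) y0] x by simp
      also have "\<dots> \<le> z * ((y / x) * F x)"
        using z y x by (intro mult_left_mono F_scale) auto
      also have "\<dots> = (z * y / x) * F x" by simp
      also have "\<dots> \<le> 1 * F x"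
        using y z x F_nonneg[OF x] by (intro mult_right_mono) (auto simp: field_simps)
      finally show "z * f x \<le> F x" by simp
    qed
  qed
  have clamp_meas: "clamp \<in> measurable M (restrict_space borel {0..1})"
    by (rule measurable_restrict_space2)
       (use clamp borel_measurable_continuous_onI[OF clamp_cont] in auto)
  define \<nu> where "\<nu> = distr M (restrict_space borel {0..1}) clamp"
  have "represents \<nu> f"
    unfolding represents_def
  proof (intro conjI allI impI)
    show "prob_space \<nu>" unfolding \<nu>_def by (rule M.prob_space_distr[OF clamp_meas])
    show "sets \<nu> = sets (restrict_space borel {0..1})" by (simp add: \<nu>_def)
    fix x :: real assume x: "0 < x"
    have "(\<integral>s. kern s x \<partial>\<nu>) = F x"
      unfolding \<nu>_def F_def
      by (rule integral_distr[OF clamp_meas])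
         (rule borel_measurable_continuous_on_restrict[OF continuous_on_kern[OF x]])
    then show "f x = (\<integral>s. inverse ((1 - s) + s * inverse x) \<partial>\<nu>)"
      using Ff[OF x] by (simp add: kern_def)
  qed
  then show ?thesis by blast
qed

lemma represents_rep_measure: "represents (rep_measure f) f"
  unfolding rep_measure_def using ex_represents by (rule someI_ex)

end

section \<open>Sectorial forms\<close>

text \<open>The assumed expression is a Hermitian form along a complex line. For
  \<open>q > 0\<close> it is tested at its minimum \<open>l = - b / q\<close>; for
  \<open>q = 0\<close> boundedness below in \<open>l\<close> forces \<open>b = 0\<close>.\<close>

lemma cauchy_schwarz_of_nonneg:
  assumes nonneg: "\<And>l :: complex. 0 \<le> p + 2 * Re (cnj l * b) + (cmod l)\<^sup>2 * q" and q: "0 \<le> q"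
  shows "(cmod b)\<^sup>2 \<le> p * q"
proof (cases "q = 0")
  case True
  have "b = 0"
  proof (rule ccontr)
    assume b: "b \<noteq> 0"
    \<comment> \<open>With this \<open>t\<close> the expression becomes
      \<open>p - 2 * (\<bar>p\<bar> + 1)\<close>, which is negative.\<close>
    define t where "t = (\<bar>p\<bar> + 1) / (cmod b)\<^sup>2"
    have "Re (cnj (- of_real t * b) * b) = - (t * (cmod b)\<^sup>2)"
      unfolding cmod_power2 by (simp add: power2_eq_square algebra_simps)
    also have "t * (cmod b)\<^sup>2 = \<bar>p\<bar> + 1" using b by (simp add: t_def)
    finally show False using nonneg[of "- of_real t * b"] True by simp
  qed
  then show ?thesis using True by simp
next
  case False
  then have q: "q > 0" using q by simp
  define l where "l = - b / of_real q"
  have "Re (cnj l * b) = - (cmod b)\<^sup>2 / q"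
    unfolding l_def cmod_power2 using q by (simp add: power2_eq_square field_simps)
  moreover have "(cmod l)\<^sup>2 * q = (cmod b)\<^sup>2 / q"
    unfolding l_def using q by (simp add: norm_divide power_divide power2_eq_square)
  ultimately have "(cmod b)\<^sup>2 / q \<le> p" using nonneg[of l] by simp
  then show ?thesis using q by (simp add: field_simps)
qed

text \<open>The Cauchy-Schwarz inequality for pairs: by the inequality of arithmetic and geometric
  means, the cross term \<open>2 * (x * y)\<close> is at most
  \<open>p * q' + p' * q\<close>.\<close>

lemma sum_le_of_square_le:
  fixes x y :: real
  assumes "x\<^sup>2 \<le> p * p'" "y\<^sup>2 \<le> q * q'" "0 \<le> p" "0 \<le> p'" "0 \<le> q" "0 \<le> q'" "0 \<le> x" "0 \<le> y"
  shows "(x + y)\<^sup>2 \<le> (p + q) * (p' + q')"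
proof -
  have "x\<^sup>2 * y\<^sup>2 \<le> (p * p') * (q * q')" using assms by (intro mult_mono) auto
  moreover have "4 * ((p * q') * (p' * q)) \<le> (p * q' + p' * q)\<^sup>2"
    using zero_le_power2[of "p * q' - p' * q"] by (simp add: power2_eq_square algebra_simps)
  ultimately have "(2 * (x * y))\<^sup>2 \<le> (p * q' + p' * q)\<^sup>2"
    by (simp add: power_mult_distrib mult_ac)
  then have "2 * (x * y) \<le> p * q' + p' * q"
    by (rule power2_le_imp_le) (use assms in auto)
  then show ?thesis using assms by (simp add: power2_eq_square algebra_simps)
qed

text \<open>The form \<open>\<Re> + i \<Im>\<close> is written through the two nonnegative forms \<open>t \<Re> \<plusminus> \<Im>\<close>, to each
  of which the Cauchy-Schwarz inequality applies.\<close>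

lemma sectorial_cauchy_schwarz_pos:
  fixes a b c d :: complex and t :: real
  defines "w \<equiv> \<lambda>l. a + l * c + cnj l * b + of_real ((cmod l)\<^sup>2) * d"
  assumes t: "0 < t" and w: "\<And>l. \<bar>Im (w l)\<bar> \<le> t * Re (w l)"
    and a: "\<bar>Im a\<bar> \<le> t * Re a" and d: "\<bar>Im d\<bar> \<le> t * Re d"
  shows "(cmod b)\<^sup>2 \<le> (1 + t\<^sup>2) * (Re a * Re d)"
proof -
  \<comment> \<open>\<open>2 * Re (cnj l * bP)\<close> is the cross term of
    \<open>t * Re (w l) - Im (w l)\<close>, and \<open>bQ\<close> plays this role for the plus sign.
    \<open>cnj c\<close> enters because \<open>b\<close> and \<open>c\<close> are not assumed
    conjugate.\<close>
  define bP where "bP = (of_real t * (b + cnj c) + \<i> * (b - cnj c)) / 2"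
  define bQ where "bQ = (of_real t * (b + cnj c) - \<i> * (b - cnj c)) / 2"
  have P: "(cmod bP)\<^sup>2 \<le> (t * Re a - Im a) * (t * Re d - Im d)"
  proof (rule cauchy_schwarz_of_nonneg)
    fix l
    have two: "2 * Re (cnj l * bP) = Re (cnj l * (of_real t * (b + cnj c) + \<i> * (b - cnj c)))"
      unfolding bP_def times_divide_eq_right Re_divide_numeral by simp
    have "t * Re (w l) - Im (w l) = (t * Re a - Im a) + 2 * Re (cnj l * bP)
        + (cmod l)\<^sup>2 * (t * Re d - Im d)"
      unfolding two by (simp add: w_def algebra_simps)
    then show "0 \<le> (t * Re a - Im a) + 2 * Re (cnj l * bP) + (cmod l)\<^sup>2 * (t * Re d - Im d)"
      using w[of l] by linarith
  qed (use d in linarith)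
  have Q: "(cmod bQ)\<^sup>2 \<le> (t * Re a + Im a) * (t * Re d + Im d)"
  proof (rule cauchy_schwarz_of_nonneg)
    fix l
    have two: "2 * Re (cnj l * bQ) = Re (cnj l * (of_real t * (b + cnj c) - \<i> * (b - cnj c)))"
      unfolding bQ_def times_divide_eq_right Re_divide_numeral by simp
    have "t * Re (w l) + Im (w l) = (t * Re a + Im a) + 2 * Re (cnj l * bQ)
        + (cmod l)\<^sup>2 * (t * Re d + Im d)"
      unfolding two by (simp add: w_def algebra_simps)
    then show "0 \<le> (t * Re a + Im a) + 2 * Re (cnj l * bQ) + (cmod l)\<^sup>2 * (t * Re d + Im d)"
      using w[of l] by linarith
  qed (use d in linarith)
  \<comment> \<open>Both multipliers have modulus \<open>sqrt (1 + t^2)\<close>, which is the origin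
    of the constant.\<close>
  have "of_real (2 * t) * b = bP * Complex 1 (- t) + bQ * Complex 1 t"
    by (simp add: bP_def bQ_def complex_eq_iff field_simps)
  then have "cmod (of_real (2 * t) * b) \<le> cmod (bP * Complex 1 (- t)) + cmod (bQ * Complex 1 t)"
    by (metis norm_triangle_ineq)
  then have "2 * t * cmod b \<le> (cmod bP + cmod bQ) * sqrt (1 + t\<^sup>2)"
    using t by (simp add: norm_mult complex_norm algebra_simps)
  then have "(2 * t * cmod b)\<^sup>2 \<le> ((cmod bP + cmod bQ) * sqrt (1 + t\<^sup>2))\<^sup>2"
    using t by (intro power_mono) auto
  then have "4 * t\<^sup>2 * (cmod b)\<^sup>2 \<le> (cmod bP + cmod bQ)\<^sup>2 * (1 + t\<^sup>2)"
    by (simp add: power_mult_distrib)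
  also have "\<dots> \<le> (((t * Re a - Im a) + (t * Re a + Im a)) * ((t * Re d - Im d) + (t * Re d + Im d))) * (1 + t\<^sup>2)"
    using a d by (intro mult_right_mono sum_le_of_square_le[OF P Q]) auto
  also have "\<dots> = 4 * t\<^sup>2 * ((1 + t\<^sup>2) * (Re a * Re d))"
    by (simp add: power2_eq_square algebra_simps)
  finally show ?thesis using t by simp
qed

lemma sectorial_cauchy_schwarz:
  fixes a b c d :: complex and t :: real
  defines "w \<equiv> \<lambda>l. a + l * c + cnj l * b + of_real ((cmod l)\<^sup>2) * d"
  assumes t: "0 \<le> t" and w: "\<And>l. \<bar>Im (w l)\<bar> \<le> t * Re (w l)" "\<And>l. 0 \<le> Re (w l)"
    and a: "\<bar>Im a\<bar> \<le> t * Re a" "0 \<le> Re a" and d: "\<bar>Im d\<bar> \<le> t * Re d" "0 \<le> Re d"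
  shows "(cmod b)\<^sup>2 \<le> (1 + t\<^sup>2) * (Re a * Re d)"
proof (rule tendsto_lowerbound)
  show "((\<lambda>t. (1 + t\<^sup>2) * (Re a * Re d)) \<longlongrightarrow> (1 + t\<^sup>2) * (Re a * Re d)) (at_right t)"
    by (intro tendsto_intros)
  show "\<forall>\<^sub>F t' in at_right t. (cmod b)\<^sup>2 \<le> (1 + t'\<^sup>2) * (Re a * Re d)"
  proof (rule eventually_at_rightI)
    fix t' assume t': "t' \<in> {t<..<t + 1}"
    have le: "\<bar>x\<bar> \<le> t' * y" if "\<bar>x\<bar> \<le> t * y" "0 \<le> y" for x y
      using that t' mult_right_mono[of t t' y] by auto
    show "(cmod b)\<^sup>2 \<le> (1 + t'\<^sup>2) * (Re a * Re d)"
      using t t' w a d unfolding w_def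
      by (intro sectorial_cauchy_schwarz_pos[of t' a c b d] le) auto
  qed simp
qed simp

text \<open>Vectors are plain functions of which only the first \<open>n\<close> values count, so
  forms can be manipulated without carrier conditions.\<close>

definition ip :: "nat \<Rightarrow> (nat \<Rightarrow> complex) \<Rightarrow> (nat \<Rightarrow> complex) \<Rightarrow> complex" where
  "ip n x y = (\<Sum>i<n. x i * cnj (y i))"

definition ap :: "nat \<Rightarrow> (nat \<Rightarrow> nat \<Rightarrow> complex) \<Rightarrow> (nat \<Rightarrow> complex) \<Rightarrow> nat \<Rightarrow> complex" where
  "ap n a x i = (\<Sum>k<n. a i k * x k)"

lemma ip_cong: "(\<And>i. i < n \<Longrightarrow> x i = x' i) \<Longrightarrow> (\<And>i. i < n \<Longrightarrow> y i = y' i) \<Longrightarrow> ip n x y = ip n x' y'"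
  by (simp add: ip_def)

lemma ap_cong: "(\<And>i. i < n \<Longrightarrow> x i = x' i) \<Longrightarrow> ap n a x = ap n a x'"
  by (rule ext) (simp add: ap_def)

lemma ip_lin_left: "ip n (\<lambda>i. l * x i + m * y i) z = l * ip n x z + m * ip n y z"
  by (simp add: ip_def sum.distrib sum_distrib_left algebra_simps)

lemma ip_lin_right: "ip n z (\<lambda>i. l * x i + m * y i) = cnj l * ip n z x + cnj m * ip n z y"
  by (simp add: ip_def sum.distrib sum_distrib_left algebra_simps)

lemma ap_lin: "ap n a (\<lambda>i. l * x i + m * y i) = (\<lambda>i. l * ap n a x i + m * ap n a y i)"
  by (rule ext) (simp add: ap_def sum.distrib sum_distrib_left algebra_simps)

lemma ip_commute: "ip n y x = cnj (ip n x y)"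
  by (simp add: ip_def mult.commute)

lemma ip_self: "ip n x x = of_real (\<Sum>i<n. (cmod (x i))\<^sup>2)"
  unfolding ip_def of_real_sum by (intro sum.cong refl) (simp only: complex_norm_square)

lemma Re_ip_self_nonneg: "0 \<le> Re (ip n x x)"
  by (simp add: ip_self sum_nonneg)

lemma Im_ip_self [simp]: "Im (ip n x x) = 0"
  by (simp add: ip_self)

lemma of_real_Re_ip_self: "of_real (Re (ip n x x)) = ip n x x"
  by (simp add: complex_eq_iff)

lemma Re_ip_self_eq_0: "Re (ip n x x) = 0 \<Longrightarrow> i < n \<Longrightarrow> x i = 0"
  by (simp add: ip_self sum_nonneg_eq_0_iff)

text \<open>A crude bound of which only finiteness matters, for the supremum defining
  \<open>r\<close> and for the form of an inverse matrix.\<close>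

lemma norm_form_le:
  "cmod (ip n (ap n a x) x) \<le> (\<Sum>i<n. \<Sum>k<n. cmod (a i k)) * Re (ip n x x)"
proof -
  have "cmod (a i k * x k * cnj (x i)) \<le> cmod (a i k) * Re (ip n x x)" if "i < n" "k < n" for i k
  proof -
    have sq: "(cmod (x j))\<^sup>2 \<le> Re (ip n x x)" if "j < n" for j
      unfolding ip_self Re_complex_of_real
      by (rule member_le_sum[where f = "\<lambda>i. (cmod (x i))\<^sup>2"]) (use that in auto)
    have "2 * (cmod (x k) * cmod (x i)) \<le> (cmod (x k))\<^sup>2 + (cmod (x i))\<^sup>2"
      using zero_le_power2[of "cmod (x k) - cmod (x i)"] by (simp add: power2_eq_square algebra_simps)
    then have "cmod (x k) * cmod (x i) \<le> Re (ip n x x)" using sq[OF that(1)] sq[OF that(2)] by linarith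
    then show ?thesis by (simp add: norm_mult mult.assoc mult_left_mono)
  qed
  then have "(\<Sum>i<n. \<Sum>k<n. cmod (a i k * x k * cnj (x i)))
    \<le> (\<Sum>i<n. \<Sum>k<n. cmod (a i k) * Re (ip n x x))"
    by (intro sum_mono) auto
  moreover have "cmod (ip n (ap n a x) x) \<le> (\<Sum>i<n. \<Sum>k<n. cmod (a i k * x k * cnj (x i)))"
    unfolding ip_def ap_def sum_distrib_right
    by (intro sum_norm_le norm_sum)
  ultimately show ?thesis by (simp add: sum_distrib_right)
qed

lemma form_expand:
  "ip n (ap n a (\<lambda>i. 1 * z i + l * u i)) (\<lambda>i. 1 * z i + l * u i)
   = ip n (ap n a z) z + l * ip n (ap n a u) z + cnj l * ip n (ap n a z) u
     + of_real ((cmod l)\<^sup>2) * ip n (ap n a u) u"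
  unfolding ap_lin ip_lin_left ip_lin_right by (simp add: complex_norm_square[symmetric] algebra_simps)

locale sectorial_form =
  fixes n :: nat and a :: "nat \<Rightarrow> nat \<Rightarrow> complex" and t :: real and r :: real
  assumes t: "0 \<le> t"
    and sect: "\<And>z. \<bar>Im (ip n (ap n a z) z)\<bar> \<le> t * Re (ip n (ap n a z) z)"
    and accr: "\<And>z. 0 \<le> Re (ip n (ap n a z) z)"
    and r: "0 < r" and le_r: "\<And>z. Re (ip n (ap n a z) z) \<le> r * Re (ip n z z)"
begin

abbreviation "\<phi> x y \<equiv> ip n (ap n a x) y"

lemma cauchy_schwarz: "(cmod (\<phi> z u))\<^sup>2 \<le> (1 + t\<^sup>2) * (Re (\<phi> z z) * Re (\<phi> u u))"
  by (rule sectorial_cauchy_schwarz[where c = "\<phi> u z"])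
     (use t sect accr in \<open>simp_all only: form_expand[symmetric]\<close>)

text \<open>Take \<open>u = ap n a z\<close> in the Cauchy-Schwarz inequality, bound the form at
  \<open>u\<close> by \<open>r\<close> times the squared norm of \<open>u\<close>, and cancel that
  squared norm.\<close>

lemma norm_ap_le: "Re (ip n (ap n a z) (ap n a z)) \<le> (1 + t\<^sup>2) * (r * Re (\<phi> z z))"
proof -
  define N where "N = Re (ip n (ap n a z) (ap n a z))"
  have N0: "0 \<le> N" by (simp add: N_def Re_ip_self_nonneg)
  have "cmod (\<phi> z (ap n a z)) = N"
    unfolding N_def ip_self norm_of_real Re_complex_of_real by (simp add: sum_nonneg)
  then have "N\<^sup>2 \<le> (1 + t\<^sup>2) * (Re (\<phi> z z) * Re (\<phi> (ap n a z) (ap n a z)))"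
    using cauchy_schwarz[of z "ap n a z"] by simp
  also have "\<dots> \<le> (1 + t\<^sup>2) * (Re (\<phi> z z) * (r * N))"
    using accr[of z] le_r[of "ap n a z"] by (intro mult_left_mono) (auto simp: N_def)
  finally have le: "N * N \<le> ((1 + t\<^sup>2) * (r * Re (\<phi> z z))) * N" by (simp add: power2_eq_square mult_ac)
  show ?thesis
  proof (cases "N = 0")
    case True
    then show ?thesis using accr[of z] r by (simp add: N_def[symmetric])
  next
    case False
    then show ?thesis using le N0 by (simp add: N_def[symmetric])
  qed
qed

context
  fixes s :: real and x z :: "nat \<Rightarrow> complex"
  assumes s: "0 \<le> s" "s \<le> 1"
    and x: "\<And>i. i < n \<Longrightarrow> x i = of_real (1 - s) * ap n a z i + of_real s * z i"
begin

lemma x_right: "ip n y x = of_real (1 - s) * ip n y (ap n a z) + of_real s * ip n y z"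
proof -
  have "ip n y x = ip n y (\<lambda>i. of_real (1 - s) * ap n a z i + of_real s * z i)"
    by (rule ip_cong) (simp_all add: x)
  then show ?thesis by (simp add: ip_lin_right)
qed

lemma x_left: "ip n x y = of_real (1 - s) * ip n (ap n a z) y + of_real s * ip n z y"
proof -
  have "ip n x y = ip n (\<lambda>i. of_real (1 - s) * ap n a z i + of_real s * z i) y"
    by (rule ip_cong) (simp_all add: x)
  then show ?thesis by (simp add: ip_lin_left)
qed

text \<open>\<open>\<phi> z x\<close> is \<open>1 - s\<close> times a squared norm plus
  \<open>s\<close> times \<open>\<phi> z z\<close>, a nonnegative combination of points of a convex
  cone.\<close>

lemma resolvent_sector:
  "\<bar>Im (\<phi> z x)\<bar> \<le> t * Re (\<phi> z x)" "0 \<le> Re (\<phi> z x)"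
proof -
  have "0 \<le> (1 - s) * Re (ip n (ap n a z) (ap n a z))"
    using s by (intro mult_nonneg_nonneg Re_ip_self_nonneg) auto
  moreover have "s * \<bar>Im (\<phi> z z)\<bar> \<le> s * (t * Re (\<phi> z z))"
    using s sect by (intro mult_left_mono) auto
  moreover have "0 \<le> s * Re (\<phi> z z)" using s accr by simp
  moreover have "0 \<le> t * ((1 - s) * Re (ip n (ap n a z) (ap n a z)))"
    using t calculation(1) by simp
  ultimately show "\<bar>Im (\<phi> z x)\<bar> \<le> t * Re (\<phi> z x)" "0 \<le> Re (\<phi> z x)"
    using s by (simp_all add: x_right abs_mult algebra_simps)
qed

text \<open>Expand both sides in \<open>N\<close>, \<open>M\<close> and \<open>b\<close> and compare
  the parts with \<open>(1 - s)^2\<close>, \<open>s^2\<close> and \<open>s * (1 - s)\<close>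
  separately. The second uses \<open>b \<le> r * M\<close>, the mixed one
  \<open>N \<le> (1 + t^2) * (r * b)\<close>.\<close>

lemma resolvent_upper:
  "((1 - s) * r + s) * Re (\<phi> z x) \<le> (1 + t\<^sup>2) * r * Re (ip n x x)"
proof -
  define N M b where "N = Re (ip n (ap n a z) (ap n a z))" and "M = Re (ip n z z)" and "b = Re (\<phi> z z)"
  have "Re (ip n z (ap n a z)) = b" unfolding b_def by (subst ip_commute) simp
  then have xx: "Re (ip n x x) = (1 - s)\<^sup>2 * N + s\<^sup>2 * M + 2 * (s * (1 - s)) * b"
    unfolding x_left by (simp add: x_right N_def M_def b_def power2_eq_square algebra_simps)
  have zx: "Re (\<phi> z x) = (1 - s) * N + s * b" by (simp add: x_right N_def b_def)
  have N0: "0 \<le> N" "0 \<le> M" by (simp_all add: N_def M_def Re_ip_self_nonneg)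
  have b0: "0 \<le> b" using accr by (simp add: b_def)
  have NB: "N \<le> (1 + t\<^sup>2) * (r * b)" using norm_ap_le by (simp add: N_def b_def)
  have bM: "b \<le> r * M" using le_r by (simp add: b_def M_def)
  have ge1: "x \<le> (1 + t\<^sup>2) * x" if "0 \<le> x" for x :: real
    using that by (simp add: algebra_simps)
  have "(1 - s)\<^sup>2 * (r * N) \<le> (1 - s)\<^sup>2 * ((1 + t\<^sup>2) * (r * N))"
    using N0 r by (intro mult_left_mono ge1) auto
  moreover have "s\<^sup>2 * b \<le> s\<^sup>2 * ((1 + t\<^sup>2) * (r * M))"
    using N0 r by (intro mult_left_mono order.trans[OF bM ge1]) auto
  moreover have "s * (1 - s) * (N + r * b) \<le> s * (1 - s) * ((1 + t\<^sup>2) * (r * b) + (1 + t\<^sup>2) * (r * b))"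
    using s NB ge1[of "r * b"] b0 r by (intro mult_left_mono add_mono) auto
  ultimately show ?thesis
    unfolding xx zx by (simp add: power2_eq_square algebra_simps)
qed

text \<open>Put C = (1 - s) A + s I, so that C z = x, and the real part of C maps x to
  \<open>\<rho>\<close> x. Nonnegativity of the real part of the form of C at z - x /
  \<open>\<rho>\<close> gives \<open>e \<le> 1 / \<rho>\<close>, and
  \<open>(1 - s) * Re (\<phi> z x) = 1 - s * e\<close> turns this into the claim. The final division
  by \<open>1 - s\<close> excludes \<open>s = 1\<close>, where \<open>z\<close> is \<open>x\<close>
  itself.\<close>

lemma resolvent_lower:
  assumes x1: "ip n x x = 1" and eig: "\<And>y. \<phi> x y + cnj (\<phi> y x) = 2 * of_real r * ip n x y"
  shows "r \<le> ((1 - s) * r + s) * Re (\<phi> z x)"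
proof (cases "s = 1")
  case True
  have "\<phi> z z = \<phi> x x" by (intro ip_cong arg_cong2[where f = "ap n"] fun_cong[OF ap_cong]) (use x True in auto)
  moreover have "Re (\<phi> x x) = r" using eig[of x] x1 by (simp add: complex_eq_iff)
  ultimately show ?thesis using True by (simp add: x_right)
next
  case False
  then have s1: "0 < 1 - s" using s by simp
  define \<rho> where "\<rho> = (1 - s) * r + s"
  have \<rho>: "0 < \<rho>" unfolding \<rho>_def using s1 r s by (intro add_pos_nonneg) auto
  \<comment> \<open>If A were Hermitian, z would equal x / \<open>\<rho>\<close>; \<open>w\<close>
    measures the deviation.\<close>
  define w where "w = (\<lambda>i. 1 * z i + of_real (- 1 / \<rho>) * x i)"
  define e where "e = Re (ip n x z)"
  have Cz: "of_real (1 - s) * \<phi> z y + of_real s * ip n z y = ip n x y" for y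
    by (simp add: x_left)
  \<comment> \<open>\<open>x\<close> is an eigenvector of the real part of A only. The equation
    \<open>eig\<close> therefore gives \<open>\<phi> x z\<close> up to the conjugate of
    \<open>\<phi> z x\<close>, which \<open>Cz\<close> supplies.\<close>
  have Cx: "Re (of_real (1 - s) * \<phi> x z + of_real s * ip n x z) = 2 * \<rho> * e - 1"
  proof -
    have "Re (\<phi> x z) + Re (\<phi> z x) = 2 * r * e"
      using arg_cong[OF eig[of z], of Re] by (simp add: e_def)
    then have "Re (\<phi> x z) = 2 * r * e - Re (\<phi> z x)" by simp
    then have "(1 - s) * Re (\<phi> x z) = (1 - s) * (2 * r * e - Re (\<phi> z x))"
      by (rule arg_cong)
    also have "\<dots> = 2 * ((1 - s) * r) * e - (1 - s) * Re (\<phi> z x)"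
      by (simp add: algebra_simps)
    finally have "(1 - s) * Re (\<phi> x z) = 2 * ((1 - s) * r) * e - (1 - s) * Re (\<phi> z x)" .
    moreover have "(1 - s) * Re (\<phi> z x) + s * e = 1"
      using arg_cong[OF Cz[of x], of Re] x1 by (simp add: e_def ip_commute[of n z x])
    moreover have "Re (of_real (1 - s) * \<phi> x z + of_real s * ip n x z) = (1 - s) * Re (\<phi> x z) + s * e"
      by (simp add: e_def)
    moreover have "2 * \<rho> * e = 2 * ((1 - s) * r) * e + 2 * (s * e)"
      by (simp add: \<rho>_def algebra_simps)
    ultimately show ?thesis by linarith
  qed
  have xx: "Re (\<phi> x x) = r" using eig[of x] x1 by (simp add: complex_eq_iff)
  have "0 \<le> (1 - s) * Re (\<phi> w w) + s * Re (ip n w w)"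
    using s accr Re_ip_self_nonneg by simp
  also have "\<dots> = Re (of_real (1 - s) * \<phi> z z + of_real s * ip n z z)
     - (1 / \<rho>) * Re (of_real (1 - s) * \<phi> x z + of_real s * ip n x z)
     - (1 / \<rho>) * Re (of_real (1 - s) * \<phi> z x + of_real s * ip n z x)
     + (1 / \<rho>)\<^sup>2 * ((1 - s) * Re (\<phi> x x) + s * Re (ip n x x))"
    unfolding w_def ap_lin ip_lin_left ip_lin_right
    by (simp add: power2_eq_square algebra_simps add_divide_distrib diff_divide_distrib)
  also have "\<dots> = e - (1 / \<rho>) * (2 * \<rho> * e - 1) - (1 / \<rho>) + (1 / \<rho>)\<^sup>2 * \<rho>"
    unfolding Cz Cx xx x1 by (simp add: e_def \<rho>_def)
  also have "\<dots> = 1 / \<rho> - e" using \<rho> by (simp add: field_simps power2_eq_square)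
  finally have "e \<le> 1 / \<rho>" by simp
  then have "\<rho> * e \<le> 1" using \<rho> by (simp add: field_simps)
  have "(1 - s) * Re (\<phi> z x) = 1 - s * e"
    using arg_cong[OF Cz[of x], of Re] x1 by (simp add: e_def ip_commute[of n z x])
  then have "(1 - s) * (\<rho> * Re (\<phi> z x)) = \<rho> - s * (\<rho> * e)"
    by (metis mult.left_commute mult.right_neutral right_diff_distrib)
  also have "\<dots> \<ge> \<rho> - s * 1" using \<open>\<rho> * e \<le> 1\<close> s by (intro diff_left_mono mult_left_mono) auto
  finally have "(1 - s) * r \<le> (1 - s) * (\<rho> * Re (\<phi> z x))" by (simp add: \<rho>_def)
  then show ?thesis using s1 by (simp add: \<rho>_def)
qed

end

end

section \<open>Bounds for the numerical radius\<close>

abbreviation ent :: "complex mat \<Rightarrow> nat \<Rightarrow> nat \<Rightarrow> complex" where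
  "ent M i j \<equiv> M $$ (i, j)"

lemma cscalar_prod_eq_ip:
  "x \<in> carrier_vec n \<Longrightarrow> y \<in> carrier_vec n \<Longrightarrow> x \<bullet>c y = ip n (\<lambda>i. x $ i) (\<lambda>i. y $ i)"
  by (simp add: scalar_prod_def ip_def atLeast0LessThan)

lemma mult_mat_vec_cscalar_prod_eq_ip:
  "M \<in> carrier_mat n n \<Longrightarrow> x \<in> carrier_vec n \<Longrightarrow> y \<in> carrier_vec n \<Longrightarrow>
    (M *\<^sub>v x) \<bullet>c y = ip n (ap n (ent M) (\<lambda>i. x $ i)) (\<lambda>i. y $ i)"
  by (simp add: cscalar_prod_mult_mat_vec ip_def ap_def sum_distrib_right)

lemma ip_vec: "ip n (ap n a (\<lambda>i. vec n x $ i)) (\<lambda>i. vec n x $ i) = ip n (ap n a x) x"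
  "ip n (\<lambda>i. vec n x $ i) (\<lambda>i. vec n x $ i) = ip n x x"
  by (simp_all add: ip_def ap_def)

lemma numerical_range_eq:
  assumes "M \<in> carrier_mat n n"
  shows "numerical_range M = {ip n (ap n (ent M) x) x | x. ip n x x = 1}"
proof (intro equalityI subsetI)
  fix w assume "w \<in> numerical_range M"
  then obtain x where x: "x \<in> carrier_vec n" "x \<bullet>c x = 1" "w = (M *\<^sub>v x) \<bullet>c x"
    using assms by (auto simp: numerical_range_def)
  then show "w \<in> {ip n (ap n (ent M) x) x | x. ip n x x = 1}"
    using assms by (auto simp: cscalar_prod_eq_ip mult_mat_vec_cscalar_prod_eq_ip)
next
  fix w assume "w \<in> {ip n (ap n (ent M) x) x | x. ip n x x = 1}"
  then obtain x where x: "ip n x x = 1" "w = ip n (ap n (ent M) x) x" by auto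
  have c: "vec n x \<in> carrier_vec n" by simp
  have "vec n x \<bullet>c vec n x = 1"
    unfolding cscalar_prod_eq_ip[OF c c] ip_vec by (rule x)
  moreover have "w = (M *\<^sub>v vec n x) \<bullet>c vec n x"
    unfolding mult_mat_vec_cscalar_prod_eq_ip[OF assms c c] ip_vec by (rule x)
  moreover have "dim_row M = n" using assms by simp
  ultimately show "w \<in> numerical_range M"
    unfolding numerical_range_def using c by blast
qed

lemma ex_unit: "0 < n \<Longrightarrow> \<exists>x. ip n x x = 1"
  by (rule exI[of _ "\<lambda>i. if i = 0 then 1 else 0"])
     (simp add: ip_def if_distrib[of cnj] if_distrib[of "\<lambda>t. t * _"] cong: if_cong)

lemma inv_mat:
  assumes M: "M \<in> carrier_mat n n" and det: "det M \<noteq> 0"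
  shows "inv_mat M \<in> carrier_mat n n" "M * inv_mat M = 1\<^sub>m n" "inv_mat M * M = 1\<^sub>m n"
proof -
  have "mat_inverse M \<noteq> None"
    using mat_inverse(1)[OF M, where b = "()"] det_non_zero_imp_unit[OF M det, where b = "()"] by blast
  then obtain G where G: "mat_inverse M = Some G" by blast
  show "inv_mat M \<in> carrier_mat n n" "M * inv_mat M = 1\<^sub>m n" "inv_mat M * M = 1\<^sub>m n"
    using mat_inverse(2)[OF M G] by (simp_all add: inv_mat_def G)
qed

text \<open>Cramer's rule; it makes the entries of an inverse continuous in a parameter as long as
  the determinant does not vanish.\<close>

lemma inv_mat_index:
  assumes M: "M \<in> carrier_mat n n" and det: "det M \<noteq> 0" and ij: "i < n" "j < n"
  shows "inv_mat M $$ (i, j) = cofactor M j i / det M"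
proof -
  note inv = inv_mat[OF M det]
  note adj = adj_mat[OF M]
  have "det M \<cdot>\<^sub>m inv_mat M = inv_mat M * (det M \<cdot>\<^sub>m 1\<^sub>m n)"
    using inv(1) by (simp add: mult_smult_distrib[of _ n n _ n] right_mult_one_mat[of _ n n])
  also have "\<dots> = inv_mat M * M * adj_mat M"
    unfolding adj(2)[symmetric] by (rule assoc_mult_mat[OF inv(1) M adj(1), symmetric])
  also have "\<dots> = adj_mat M" unfolding inv(3) by (rule left_mult_one_mat[OF adj(1)])
  finally have "(det M \<cdot>\<^sub>m inv_mat M) $$ (i, j) = adj_mat M $$ (i, j)" by simp
  then have "det M * inv_mat M $$ (i, j) = cofactor M j i"
    using ij inv(1) M by (simp add: adj_mat_def)
  then show ?thesis using det by (simp add: field_simps)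
qed

lemma ap_mult:
  assumes "M \<in> carrier_mat n n" "N \<in> carrier_mat n n" "i < n"
  shows "ap n (ent M) (ap n (ent N) x) i = ap n (ent (M * N)) x i"
proof -
  have "ap n (ent (M * N)) x i = (\<Sum>k<n. (\<Sum>j<n. M $$ (i, j) * N $$ (j, k)) * x k)"
    unfolding ap_def using assms by (intro sum.cong refl) (auto simp: scalar_prod_def atLeast0LessThan)
  also have "\<dots> = (\<Sum>j<n. \<Sum>k<n. M $$ (i, j) * (N $$ (j, k) * x k))"
    unfolding sum_distrib_right by (subst sum.swap) (simp add: mult.assoc)
  finally show ?thesis by (simp add: ap_def sum_distrib_left)
qed

lemma ap_one: "i < n \<Longrightarrow> ap n (ent (1\<^sub>m n)) x i = x i"
  by (simp add: ap_def if_distrib[of "\<lambda>t. t * _"] cong: if_cong)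

lemma det_nonzeroI:
  assumes M: "M \<in> carrier_mat n n"
    and inj: "\<And>x. (\<And>i. i < n \<Longrightarrow> ap n (ent M) x i = 0) \<Longrightarrow> (\<And>i. i < n \<Longrightarrow> x i = 0)"
  shows "det M \<noteq> 0"
proof
  assume "det M = 0"
  then obtain v where v: "v \<in> carrier_vec n" "v \<noteq> 0\<^sub>v n" "M *\<^sub>v v = 0\<^sub>v n"
    using det_0_iff_vec_prod_zero[OF M] by blast
  have "ap n (ent M) (\<lambda>i. v $ i) i = 0" if "i < n" for i
  proof -
    have "(M *\<^sub>v v) $ i = 0" using v that by simp
    then show ?thesis using that M v(1) by (simp add: ap_def scalar_prod_def atLeast0LessThan)
  qed
  then have "v $ i = 0" if "i < n" for i using inj[of "\<lambda>i. v $ i"] that by blast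
  then have "v = 0\<^sub>v n" using v(1) by (intro eq_vecI) auto
  with v(2) show False by simp
qed

lemma continuous_on_det:
  fixes M :: "'b::topological_space \<Rightarrow> complex mat"
  assumes "\<And>s. M s \<in> carrier_mat m m"
    and "\<And>i j. i < m \<Longrightarrow> j < m \<Longrightarrow> continuous_on T (\<lambda>s. M s $$ (i, j))"
  shows "continuous_on T (\<lambda>s. det (M s))"
  unfolding det_def'[OF assms(1)]
  by (intro continuous_intros assms(2)) (auto dest: permutes_in_image[of _ "{0..<m}"])

lemma continuous_on_cofactor:
  fixes M :: "'b::topological_space \<Rightarrow> complex mat"
  assumes "\<And>s. M s \<in> carrier_mat m m" "i < m" "j < m"
    and "\<And>i j. i < m \<Longrightarrow> j < m \<Longrightarrow> continuous_on T (\<lambda>s. M s $$ (i, j))"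
  shows "continuous_on T (\<lambda>s. cofactor (M s) i j)"
proof -
  have d: "dim_row (M s) = m" "dim_col (M s) = m" for s using assms(1)[of s] by auto
  have "continuous_on T (\<lambda>s. det (mat_delete (M s) i j))"
  proof (rule continuous_on_det[where m = "m - 1"])
    show "mat_delete (M s) i j \<in> carrier_mat (m - 1) (m - 1)" for s
      using mat_delete_carrier[OF assms(1)] .
    show "continuous_on T (\<lambda>s. mat_delete (M s) i j $$ (k, l))" if "k < m - 1" "l < m - 1" for k l
      using that by (auto simp: mat_delete_def d intro!: assms(4))
  qed
  then show ?thesis unfolding cofactor_def by (intro continuous_intros)
qed

section \<open>Integrals against a representing measure\<close>

lemma integrable_continuous_on_unit_interval:
  fixes g :: "real \<Rightarrow> 'b::{banach, second_countable_topology}"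
  assumes \<nu>: "prob_space \<nu>" "sets \<nu> = sets (restrict_space borel {0..1::real})"
    and g: "continuous_on {0..1} g"
  shows "integrable \<nu> g"
proof -
  interpret prob_space \<nu> by fact
  have "g \<in> borel_measurable (restrict_space borel {0..1})"
    using g by (rule borel_measurable_continuous_on_restrict)
  then have meas: "g \<in> borel_measurable \<nu>" using measurable_cong_sets[OF \<nu>(2) refl] by blast
  have space: "space \<nu> = {0..1}" using sets_eq_imp_space_eq[OF \<nu>(2)] by (simp add: space_restrict_space)
  have "bounded (g ` {0..1})"
    using g by (intro compact_imp_bounded compact_continuous_image) auto
  then obtain C where "\<forall>y\<in>g ` {0..1}. norm y \<le> C" unfolding bounded_iff by blast
  then show ?thesis
    by (intro integrable_const_bound[of _ C] meas AE_I2) (auto simp: space)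
qed

lemma represents_space: "represents \<nu> f \<Longrightarrow> space \<nu> = {0..1}"
  unfolding represents_def using sets_eq_imp_space_eq[of \<nu> "restrict_space borel {0..1::real}"]
  by (simp add: space_restrict_space)

lemma represents_integrable:
  fixes g :: "real \<Rightarrow> 'b::{banach, second_countable_topology}"
  shows "represents \<nu> f \<Longrightarrow> continuous_on {0..1} g \<Longrightarrow> integrable \<nu> g"
  unfolding represents_def by (blast intro: integrable_continuous_on_unit_interval)

lemma represents_eq: "represents \<nu> f \<Longrightarrow> 0 < x \<Longrightarrow> f x = (\<integral>s. kern s x \<partial>\<nu>)"
  by (simp add: represents_def kern_def)

lemma represents_mono:
  assumes \<nu>: "represents \<nu> f" and x: "0 < x" "x \<le> y"
  shows "f x \<le> f y"
proof -
  have "0 < y" using x by simp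
  then show ?thesis
    unfolding represents_eq[OF \<nu> x(1)] represents_eq[OF \<nu> \<open>0 < y\<close>] using x
    by (intro integral_mono represents_integrable[OF \<nu>] continuous_on_kern kern_mono)
       (auto simp: represents_space[OF \<nu>])
qed

lemma represents_scale_le:
  assumes \<nu>: "represents \<nu> f" and x: "0 < x" and c: "1 \<le> c"
  shows "f (c * x) \<le> c * f x"
proof -
  have cx: "0 < c * x" using x c by simp
  have "(\<integral>s. kern s (c * x) \<partial>\<nu>) \<le> (\<integral>s. c * kern s x \<partial>\<nu>)"
    using x c cx
    by (intro integral_mono represents_integrable[OF \<nu>] continuous_on_kern continuous_on_mult_left kern_scale_le)
       (auto simp: represents_space[OF \<nu>])
  then show ?thesis
    unfolding represents_eq[OF \<nu> x] represents_eq[OF \<nu> cx] by simp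
qed

lemma complex_norm_le_sector:
  assumes "0 \<le> t" "\<bar>Im z\<bar> \<le> t * Re z" "0 \<le> Re z"
  shows "cmod z \<le> sqrt (1 + t\<^sup>2) * Re z"
proof -
  have "(Im z)\<^sup>2 \<le> (t * Re z)\<^sup>2" using assms(2) by (metis abs_ge_zero power2_abs power_mono)
  then have "(cmod z)\<^sup>2 \<le> (sqrt (1 + t\<^sup>2) * Re z)\<^sup>2"
    by (simp add: cmod_power2 power_mult_distrib algebra_simps)
  then show ?thesis by (rule power2_le_imp_le) (use assms in simp)
qed

section \<open>The form of a sectorial accretive matrix and the largest eigenvalue of its real
  part\<close>

locale accretive_sectorial =
  fixes n :: nat and \<alpha> :: real and A :: "complex mat"
  assumes n: "0 < n" and \<alpha>: "0 \<le> \<alpha>" "\<alpha> < pi / 2"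
    and A: "A \<in> carrier_mat n n" and sectA: "sectorial \<alpha> A" and accA: "accretive A"
begin

abbreviation "a \<equiv> ent A"
abbreviation "\<Phi> x y \<equiv> ip n (ap n a x) y"

text \<open>As a supremum, \<open>r\<close> bounds the form without spectral theory;
  \<open>ex_top_eigenvector\<close> then shows that it is an eigenvalue of the real part.\<close>

definition "r = Sup {Re (\<Phi> x x) | x. ip n x x = 1}"

lemma tan_nonneg: "0 \<le> tan \<alpha>"
  using \<alpha> tan_pos_pi2_le[of \<alpha>] by simp

lemma cos_pos: "0 < cos \<alpha>"
  using \<alpha> by (intro cos_gt_zero_pi) auto

lemma one_plus_tan_square: "1 + (tan \<alpha>)\<^sup>2 = (1 / cos \<alpha>)\<^sup>2" "sqrt (1 + (tan \<alpha>)\<^sup>2) = 1 / cos \<alpha>"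
proof -
  show *: "1 + (tan \<alpha>)\<^sup>2 = (1 / cos \<alpha>)\<^sup>2"
    using tan_sec[of \<alpha>] cos_pos by (simp add: inverse_eq_divide)
  show "sqrt (1 + (tan \<alpha>)\<^sup>2) = 1 / cos \<alpha>"
    unfolding * using cos_pos by (simp add: real_sqrt_divide)
qed

lemma homogeneous:
  assumes "ip n z z \<noteq> 0"
  obtains c x where "0 < c" "ip n x x = 1" "\<Phi> z z = of_real c * \<Phi> x x" "ip n z z = of_real c"
proof -
  define c where "c = Re (ip n z z)"
  have c0: "c \<noteq> 0" using assms of_real_Re_ip_self[of n z] unfolding c_def by auto
  then have c: "0 < c" using Re_ip_self_nonneg[of n z] by (simp add: c_def)
  define x where "x = (\<lambda>i. of_real (1 / sqrt c) * z i + 0 * z i)"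
  have sq: "complex_of_real (1 / sqrt c) * complex_of_real (1 / sqrt c) = of_real (1 / c)"
    using c unfolding of_real_mult[symmetric] by simp
  have xx: "ip n x x = of_real (1 / c) * ip n z z"
    unfolding x_def ip_lin_left ip_lin_right sq[symmetric] by (simp add: mult.assoc)
  have "\<Phi> x x = of_real (1 / c) * \<Phi> z z"
    unfolding x_def ap_lin ip_lin_left ip_lin_right sq[symmetric] by (simp add: mult.assoc)
  then have \<Phi>z: "\<Phi> z z = of_real c * \<Phi> x x" using c by simp
  have zz: "ip n z z = of_real c" unfolding c_def by (rule of_real_Re_ip_self[symmetric])
  have "ip n x x = 1" unfolding xx zz of_real_mult[symmetric] using c by simp
  then show ?thesis by (rule that[OF c _ \<Phi>z zz])
qed

lemma zero_form: assumes "ip n z z = 0" shows "\<Phi> z z = 0"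
proof -
  have "z i = 0" if "i < n" for i
    using Re_ip_self_eq_0[of n z i] that assms by simp
  then show ?thesis by (simp add: ip_def)
qed

lemma in_range: "ip n x x = 1 \<Longrightarrow> \<Phi> x x \<in> numerical_range A"
  unfolding numerical_range_eq[OF A] by blast

lemma form_sector: "\<bar>Im (\<Phi> z z)\<bar> \<le> tan \<alpha> * Re (\<Phi> z z)"
proof (cases "ip n z z = 0")
  case True
  then show ?thesis by (simp add: zero_form)
next
  case False
  then obtain c x where x: "0 < c" "ip n x x = 1" "\<Phi> z z = of_real c * \<Phi> x x"
    by (rule homogeneous)
  have "\<bar>Im (\<Phi> x x)\<bar> \<le> tan \<alpha> * Re (\<Phi> x x)"
    using in_range[OF x(2)] sectA unfolding sectorial_def sector_def by blast
  then have "c * \<bar>Im (\<Phi> x x)\<bar> \<le> c * (tan \<alpha> * Re (\<Phi> x x))" using x(1) by (intro mult_left_mono) auto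
  then show ?thesis using x(1) unfolding x(3) by (simp add: abs_mult mult_ac)
qed

text \<open>The form of \<open>real_part_mat A\<close> at \<open>z\<close> is the mean of
  \<open>\<Phi> z z\<close> and its conjugate.\<close>

lemma form_pos: "ip n z z \<noteq> 0 \<Longrightarrow> 0 < Re (\<Phi> z z)"
proof -
  assume z: "ip n z z \<noteq> 0"
  define v where "v = vec n z"
  have v: "v \<in> carrier_vec n" by (simp add: v_def)
  have "v \<noteq> 0\<^sub>v n"
  proof
    assume v0: "v = 0\<^sub>v n"
    have "z i = 0" if "i < n" for i
      using that arg_cong[OF v0, of "\<lambda>v. v $ i"] by (simp add: v_def)
    then have "ip n z z = 0" by (simp add: ip_def)
    with z show False ..
  qed
  define R where "R = real_part_mat A"
  have Rc: "R \<in> carrier_mat n n" using A by (simp add: R_def real_part_mat_def)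
  have "0 < Re ((R *\<^sub>v v) \<bullet>c v)"
    using accA v \<open>v \<noteq> 0\<^sub>v n\<close> Rc by (simp add: accretive_def pos_def_def R_def[symmetric])
  also have "(R *\<^sub>v v) \<bullet>c v = ip n (ap n (ent R) (\<lambda>i. v $ i)) (\<lambda>i. v $ i)"
    by (rule mult_mat_vec_cscalar_prod_eq_ip[OF Rc v v])
  also have "\<dots> = ip n (ap n (ent R) z) z"
    unfolding v_def by (rule ip_vec)
  also have "\<dots> = (\<Phi> z z + ip n (ap n (\<lambda>i k. cnj (a k i)) z) z) / 2"
  proof -
    have "ip n (ap n (ent R) z) z = ip n (\<lambda>i. (1 / 2) * ap n a z i + (1 / 2) * ap n (\<lambda>i k. cnj (a k i)) z i) z"
    proof (rule ip_cong)
      fix i assume i: "i < n"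
      have "ap n (ent R) z i = (\<Sum>k<n. (1 / 2) * (a i k * z k) + (1 / 2) * (cnj (a k i) * z k))"
        unfolding ap_def using i A
        by (intro sum.cong refl) (auto simp: R_def real_part_mat_def algebra_simps)
      then show "ap n (ent R) z i = (1 / 2) * ap n a z i + (1 / 2) * ap n (\<lambda>i k. cnj (a k i)) z i"
        by (simp only: ap_def sum.distrib sum_distrib_left)
    qed simp
    then show ?thesis unfolding ip_lin_left by simp
  qed
  also have "ip n (ap n (\<lambda>i k. cnj (a k i)) z) z = cnj (\<Phi> z z)"
    unfolding ip_def ap_def sum_distrib_right cnj_sum
    by (subst sum.swap) (simp add: mult_ac)
  finally show ?thesis by simp
qed

lemma form_nonneg: "0 \<le> Re (\<Phi> z z)"
  using form_pos[of z] zero_form[of z] by (cases "ip n z z = 0") auto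

lemma form_zero: "Re (\<Phi> z z) = 0 \<Longrightarrow> i < n \<Longrightarrow> z i = 0"
  using form_pos[of z] Re_ip_self_eq_0[of n z i] by (cases "ip n z z = 0") auto

lemma bdd_form: "bdd_above {Re (\<Phi> x x) | x. ip n x x = 1}"
proof (rule bdd_aboveI)
  fix y assume "y \<in> {Re (\<Phi> x x) | x. ip n x x = 1}"
  then obtain x where x: "ip n x x = 1" "y = Re (\<Phi> x x)" by auto
  then show "y \<le> (\<Sum>i<n. \<Sum>k<n. cmod (a i k))"
    using norm_form_le[of n a x] complex_Re_le_cmod[of "\<Phi> x x"] by simp
qed

lemma unit_le_r: "ip n x x = 1 \<Longrightarrow> Re (\<Phi> x x) \<le> r"
  unfolding r_def by (rule cSup_upper[OF _ bdd_form]) auto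

lemma r_pos: "0 < r"
proof -
  obtain x where x: "ip n x x = 1" using ex_unit[OF n] by blast
  then show ?thesis using form_pos[of x] unit_le_r[OF x] by simp
qed

lemma form_le_r: "Re (\<Phi> z z) \<le> r * Re (ip n z z)"
proof (cases "ip n z z = 0")
  case True
  then show ?thesis by (simp add: zero_form)
next
  case False
  then obtain c x where x: "0 < c" "ip n x x = 1" "\<Phi> z z = of_real c * \<Phi> x x" "ip n z z = of_real c"
    by (rule homogeneous)
  then show ?thesis using unit_le_r[OF x(2)] by simp
qed

sublocale sectorial_form n a "tan \<alpha>" r
  by standard (rule tan_nonneg form_sector form_nonneg r_pos form_le_r)+

text \<open>If \<open>M = r I - \<Re> A\<close> were invertible, the Cauchy-Schwarz inequality for the form of \<open>M\<close> would bound
  that form away from zero on the unit sphere, contradicting the choice of \<open>r\<close>.\<close>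

lemma ex_top_eigenvector:
  "\<exists>x. ip n x x = 1 \<and> (\<forall>y. \<Phi> x y + cnj (\<Phi> y x) = 2 * of_real r * ip n x y)"
proof -
  \<comment> \<open>Here \<open>M\<close> carries an extra factor 2, so its form at a unit vector is
    \<open>2 * (r - Re (\<Phi> x x))\<close>; hence the 2 in the gap
    \<open>1 / (2 * K)\<close>.\<close>
  define M where "M = mat n n (\<lambda>(i, k). (if i = k then 2 * of_real r else 0) - a i k - cnj (a k i))"
  have M: "M \<in> carrier_mat n n" by (simp add: M_def)
  have form: "ip n (ap n (ent M) x) y = 2 * of_real r * ip n x y - \<Phi> x y - cnj (\<Phi> y x)" for x y
  proof -
    have "ap n (ent M) x i = 2 * of_real r * x i - ap n a x i - (\<Sum>k<n. cnj (a k i) * x k)" if "i < n" for i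
    proof -
      have "ap n (ent M) x i = (\<Sum>k<n. (if k = i then 2 * of_real r * x i else 0) - a i k * x k - cnj (a k i) * x k)"
        unfolding ap_def using that by (intro sum.cong refl) (auto simp: M_def algebra_simps)
      then show ?thesis using that by (simp add: sum_subtractf ap_def)
    qed
    then have "ip n (ap n (ent M) x) y
       = (\<Sum>i<n. 2 * of_real r * (x i * cnj (y i)) - ap n a x i * cnj (y i) - (\<Sum>k<n. cnj (a k i) * x k) * cnj (y i))"
      unfolding ip_def by (intro sum.cong refl) (simp add: left_diff_distrib mult.assoc)
    also have "\<dots> = 2 * of_real r * ip n x y - \<Phi> x y - (\<Sum>i<n. (\<Sum>k<n. cnj (a k i) * x k) * cnj (y i))"
      by (simp add: sum_subtractf ip_def sum_distrib_left)
    also have "(\<Sum>i<n. (\<Sum>k<n. cnj (a k i) * x k) * cnj (y i)) = cnj (\<Phi> y x)"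
      unfolding ip_def ap_def sum_distrib_right cnj_sum by (subst sum.swap) (simp add: mult_ac)
    finally show ?thesis .
  qed
  have M_nonneg: "0 \<le> Re (ip n (ap n (ent M) x) x)" for x
    unfolding form using form_le_r[of x] by simp
  have "det M = 0"
  proof (rule ccontr)
    assume det: "det M \<noteq> 0"
    note G = inv_mat[OF M det]
    define K where "K = (\<Sum>i<n. \<Sum>k<n. cmod (inv_mat M $$ (i, k))) + 1"
    have K: "K > 0" unfolding K_def by (intro add_nonneg_pos sum_nonneg) auto
    have "Re (\<Phi> x x) \<le> r - 1 / (2 * K)" if x: "ip n x x = 1" for x
    proof -
      \<comment> \<open>With this \<open>u\<close>, the image of \<open>x\<close> under the inverse
        of \<open>M\<close>, the mixed term is <M x, u> = <x, M u> = 1. So the product of <M x, x>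
        and <x, u> is at least 1, while \<open>K\<close> bounds the latter.\<close>
      define u where "u = ap n (ent (inv_mat M)) x"
      have Mu: "ap n (ent M) u i = x i" if "i < n" for i
        unfolding u_def ap_mult[OF M G(1) that] G(2) by (rule ap_one[OF that])
      have Mux: "ip n (ap n (ent M) u) y = ip n x y" for y
        by (rule ip_cong) (simp_all add: Mu)
      have herm: "ip n (ap n (ent M) x) u = 1"
      proof -
        have "ip n (ap n (ent M) x) u = cnj (ip n (ap n (ent M) u) x)"
          unfolding form by (simp add: ip_commute[of n x u])
        then show ?thesis by (simp add: Mux x)
      qed
      have "(cmod (ip n (ap n (ent M) x) u))\<^sup>2 \<le> Re (ip n (ap n (ent M) x) x) * Re (ip n (ap n (ent M) u) u)"
      proof (rule cauchy_schwarz_of_nonneg)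
        fix l
        have "0 \<le> Re (ip n (ap n (ent M) (\<lambda>i. 1 * x i + l * u i)) (\<lambda>i. 1 * x i + l * u i))"
          by (rule M_nonneg)
        also have "\<dots> = Re (ip n (ap n (ent M) x) x) + 2 * Re (cnj l * ip n (ap n (ent M) x) u)
           + (cmod l)\<^sup>2 * Re (ip n (ap n (ent M) u) u)"
          unfolding form_expand by (simp add: Mux x herm)
        finally show "0 \<le> Re (ip n (ap n (ent M) x) x) + 2 * Re (cnj l * ip n (ap n (ent M) x) u)
           + (cmod l)\<^sup>2 * Re (ip n (ap n (ent M) u) u)" .
      qed (rule M_nonneg)
      then have "1 \<le> Re (ip n (ap n (ent M) x) x) * Re (ip n x u)" unfolding herm Mux by simp
      also have "\<dots> \<le> Re (ip n (ap n (ent M) x) x) * K"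
      proof (intro mult_left_mono M_nonneg)
        have "Re (ip n x u) \<le> cmod (ip n u x)"
          using complex_Re_le_cmod[of "ip n u x"] by (simp add: ip_commute[of n x u])
        also have "\<dots> \<le> K"
          using norm_form_le[of n "ent (inv_mat M)" x] x by (simp add: u_def K_def)
        finally show "Re (ip n x u) \<le> K" .
      qed
      also have "Re (ip n (ap n (ent M) x) x) = 2 * (r - Re (\<Phi> x x))"
        unfolding form x by simp
      finally show ?thesis using K by (simp add: field_simps)
    qed
    then have "r \<le> r - 1 / (2 * K)"
      unfolding r_def using ex_unit[OF n] by (intro cSup_least) (auto simp: r_def)
    then show False using K by simp
  qed
  then obtain v where v: "v \<in> carrier_vec n" "v \<noteq> 0\<^sub>v n" "M *\<^sub>v v = 0\<^sub>v n"
    using det_0_iff_vec_prod_zero[OF M] by blast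
  define z where "z i = v $ i" for i
  have Mz: "ap n (ent M) z i = 0" if "i < n" for i
  proof -
    have "(M *\<^sub>v v) $ i = 0" using v that by simp
    then show ?thesis using that M v(1) by (simp add: ap_def scalar_prod_def atLeast0LessThan z_def)
  qed
  define c where "c = Re (ip n z z)"
  have "c \<noteq> 0"
  proof
    assume "c = 0"
    then have "v = 0\<^sub>v n"
      using v(1) Re_ip_self_eq_0[of n z] by (intro eq_vecI) (auto simp: c_def z_def)
    with v(2) show False ..
  qed
  then have c: "0 < c" using Re_ip_self_nonneg[of n z] by (simp add: c_def)
  define x where "x = (\<lambda>i. of_real (1 / sqrt c) * z i + 0 * z i)"
  have sq: "complex_of_real (1 / sqrt c) * complex_of_real (1 / sqrt c) = of_real (1 / c)"
    using c unfolding of_real_mult[symmetric] by simp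
  have xx: "ip n x x = of_real (1 / c) * ip n z z"
    unfolding x_def ip_lin_left ip_lin_right sq[symmetric] by (simp add: mult.assoc)
  have zz: "ip n z z = of_real c" unfolding c_def by (rule of_real_Re_ip_self[symmetric])
  have "ip n x x = 1" unfolding xx zz of_real_mult[symmetric] using c by simp
  moreover have "\<Phi> x y + cnj (\<Phi> y x) = 2 * of_real r * ip n x y" for y
  proof -
    have "ip n (ap n (ent M) x) y = ip n (\<lambda>i. 0) y"
    proof (rule ip_cong)
      show "ap n (ent M) x i = 0" if "i < n" for i
        unfolding x_def ap_lin using Mz[OF that] by simp
    qed simp
    then have "ip n (ap n (ent M) x) y = 0" by (simp add: ip_def)
    then show ?thesis unfolding form by (simp add: algebra_simps)
  qed
  ultimately show ?thesis by blast
qed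

section \<open>The resolvents under the integral\<close>

definition "invA = inv_mat A"
definition "B s = complex_of_real (1 - s) \<cdot>\<^sub>m 1\<^sub>m n + complex_of_real s \<cdot>\<^sub>m invA"
definition "H s = inv_mat (B s)"

lemma det_A: "det A \<noteq> 0"
proof (rule det_nonzeroI[OF A])
  fix x i assume 0: "\<And>i. i < n \<Longrightarrow> ap n a x i = 0" and i: "i < n"
  have "\<Phi> x x = 0" by (simp add: ip_def 0)
  then show "x i = 0" using form_zero[of x i] i by simp
qed

lemma invA: "invA \<in> carrier_mat n n" "A * invA = 1\<^sub>m n"
  unfolding invA_def using inv_mat[OF A det_A] by auto

lemma B: "B s \<in> carrier_mat n n"
  using invA by (simp add: B_def)

lemma ap_B: "i < n \<Longrightarrow> ap n (ent (B s)) y i = of_real (1 - s) * y i + of_real s * ap n (ent invA) y i"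
proof -
  assume i: "i < n"
  have "ap n (ent (B s)) y i = (\<Sum>k<n. (if k = i then of_real (1 - s) * y i else 0) + of_real s * (invA $$ (i, k) * y k))"
    unfolding ap_def using i invA(1) by (intro sum.cong refl) (auto simp: B_def algebra_simps)
  then show ?thesis using i by (simp add: sum.distrib sum_distrib_left ap_def)
qed

text \<open>Substituting \<open>y = A z\<close> removes the inverse of A: the image of
  \<open>y\<close> under \<open>B s\<close> is expressed by A z and z alone, the shape that the
  resolvent estimates require.\<close>

lemma resolvent_system:
  fixes y
  defines "z \<equiv> ap n (ent invA) y"
  shows "i < n \<Longrightarrow> ap n a z i = y i"
    "i < n \<Longrightarrow> ap n (ent (B s)) y i = of_real (1 - s) * ap n a z i + of_real s * z i"
proof -
  show *: "ap n a z i = y i" if "i < n" for i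
    unfolding z_def ap_mult[OF A invA(1) that] invA(2) by (rule ap_one[OF that])
  show "i < n \<Longrightarrow> ap n (ent (B s)) y i = of_real (1 - s) * ap n a z i + of_real s * z i"
    using * by (simp add: ap_B z_def)
qed

text \<open>If \<open>B s\<close> kills \<open>y\<close>, pairing the equation for \<open>z\<close>
  with A z writes 0 as a sum of two nonnegative terms. For \<open>s = 0\<close> this gives A z = 0,
  otherwise z = 0; in both cases \<open>y\<close>, being A z, vanishes.\<close>

lemma det_B:
  assumes s: "0 \<le> s" "s \<le> 1"
  shows "det (B s) \<noteq> 0"
proof (rule det_nonzeroI[OF B])
  fix y i assume 0: "\<And>i. i < n \<Longrightarrow> ap n (ent (B s)) y i = 0" and i: "i < n"
  define z where "z = ap n (ent invA) y"
  have x: "0 = of_real (1 - s) * ap n a z i + of_real s * z i" if "i < n" for i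
    using resolvent_system(2)[of i s y] 0[OF that] that by (simp add: z_def)
  have "\<Phi> z (\<lambda>i. 0) = 0" by (simp add: ip_def)
  then have "(1 - s) * Re (ip n (ap n a z) (ap n a z)) + s * Re (\<Phi> z z) = 0"
    using arg_cong[OF x_right[OF s, of "\<lambda>i. 0" z "ap n a z"], of Re] x by simp
  moreover have "0 \<le> (1 - s) * Re (ip n (ap n a z) (ap n a z))" "0 \<le> s * Re (\<Phi> z z)"
    using s form_nonneg Re_ip_self_nonneg by simp_all
  ultimately have eq: "(1 - s) * Re (ip n (ap n a z) (ap n a z)) = 0" "s * Re (\<Phi> z z) = 0"
    by linarith+
  show "y i = 0"
  proof (cases "s = 0")
    case True
    then show ?thesis using eq(1) Re_ip_self_eq_0[of n "ap n a z" i] i resolvent_system(1)[of i y]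
      by (simp add: z_def)
  next
    case False
    then have "z j = 0" if "j < n" for j using eq(2) form_zero[of z j] that by simp
    then have "ap n a z i = 0" by (simp add: ap_def)
    then show ?thesis using resolvent_system(1)[of i y] i by (simp add: z_def)
  qed
qed

lemma H: "0 \<le> s \<Longrightarrow> s \<le> 1 \<Longrightarrow> H s \<in> carrier_mat n n \<and> B s * H s = 1\<^sub>m n"
  unfolding H_def using inv_mat[OF B det_B] by blast

lemma H_form:
  assumes s: "0 \<le> s" "s \<le> 1"
  obtains z where "\<And>i. i < n \<Longrightarrow> x i = of_real (1 - s) * ap n a z i + of_real s * z i"
    "ip n (ap n (ent (H s)) x) x = \<Phi> z x"
proof
  define z where "z = ap n (ent invA) (ap n (ent (H s)) x)"
  show "x i = of_real (1 - s) * ap n a z i + of_real s * z i" if "i < n" for i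
  proof -
    have "x i = ap n (ent (B s)) (ap n (ent (H s)) x) i"
      using ap_mult[OF B _ that] H[OF s] ap_one[OF that] by simp
    then show ?thesis using resolvent_system(2)[OF that] by (simp add: z_def)
  qed
  show "ip n (ap n (ent (H s)) x) x = \<Phi> z x"
    by (rule ip_cong) (simp_all add: z_def resolvent_system(1))
qed

lemma H_sector:
  assumes s: "0 \<le> s" "s \<le> 1"
  shows "\<bar>Im (ip n (ap n (ent (H s)) x) x)\<bar> \<le> tan \<alpha> * Re (ip n (ap n (ent (H s)) x) x)"
    "0 \<le> Re (ip n (ap n (ent (H s)) x) x)"
proof -
  obtain z where z: "\<And>i. i < n \<Longrightarrow> x i = of_real (1 - s) * ap n a z i + of_real s * z i"
    "ip n (ap n (ent (H s)) x) x = \<Phi> z x" using H_form[OF s, of x] by blast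
  show "\<bar>Im (ip n (ap n (ent (H s)) x) x)\<bar> \<le> tan \<alpha> * Re (ip n (ap n (ent (H s)) x) x)"
    "0 \<le> Re (ip n (ap n (ent (H s)) x) x)"
    unfolding z(2) using resolvent_sector[OF s z(1)] by simp_all
qed

lemma kern_r: "0 \<le> s \<Longrightarrow> s \<le> 1 \<Longrightarrow> 0 < (1 - s) * r + s \<and> kern s r = r / ((1 - s) * r + s)"
proof -
  assume s: "0 \<le> s" "s \<le> 1"
  have "(1 - s) * r + s = r * ((1 - s) + s * inverse r)" using r_pos by (simp add: field_simps)
  then show ?thesis using kern_pos[OF s r_pos] r_pos by (simp add: kern_def field_simps)
qed

lemma H_upper:
  assumes s: "0 \<le> s" "s \<le> 1" and x: "ip n x x = 1"
  shows "Re (ip n (ap n (ent (H s)) x) x) \<le> (1 + (tan \<alpha>)\<^sup>2) * kern s r"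
proof -
  obtain z where z: "\<And>i. i < n \<Longrightarrow> x i = of_real (1 - s) * ap n a z i + of_real s * z i"
    "ip n (ap n (ent (H s)) x) x = \<Phi> z x" using H_form[OF s, of x] by blast
  show ?thesis
    using resolvent_upper[OF s z(1)] kern_r[OF s] x unfolding z(2) by (simp add: field_simps)
qed

lemma H_lower:
  assumes s: "0 \<le> s" "s \<le> 1" and x: "ip n x x = 1"
    and eig: "\<And>y. \<Phi> x y + cnj (\<Phi> y x) = 2 * of_real r * ip n x y"
  shows "kern s r \<le> Re (ip n (ap n (ent (H s)) x) x)"
proof -
  obtain z where z: "\<And>i. i < n \<Longrightarrow> x i = of_real (1 - s) * ap n a z i + of_real s * z i"
    "ip n (ap n (ent (H s)) x) x = \<Phi> z x" using H_form[OF s, of x] by blast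
  show ?thesis
    using resolvent_lower[OF s z(1) x eig] kern_r[OF s] unfolding z(2) by (simp add: field_simps)
qed

lemma continuous_on_H: "i < n \<Longrightarrow> j < n \<Longrightarrow> continuous_on {0..1} (\<lambda>s. H s $$ (i, j))"
proof -
  assume ij: "i < n" "j < n"
  have B_cont: "continuous_on {0..1} (\<lambda>s. B s $$ (i, j))" if "i < n" "j < n" for i j
    using that invA(1) unfolding B_def by (auto intro!: continuous_intros)
  have "continuous_on {0..1} (\<lambda>s. cofactor (B s) j i / det (B s))"
    using ij det_B
    by (intro continuous_on_divide continuous_on_cofactor[where m = n] continuous_on_det[where m = n] B B_cont) auto
  then show ?thesis
    by (rule continuous_on_eq) (use inv_mat_index[OF B det_B ij] in \<open>auto simp: H_def\<close>)
qed

lemma continuous_on_H_form: "continuous_on {0..1} (\<lambda>s. ip n (ap n (ent (H s)) x) x)"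
  unfolding ip_def ap_def by (intro continuous_intros continuous_on_H) auto

section \<open>Integration over the parameter and the numerical radii\<close>

lemma accretive_fun_form:
  assumes \<nu>: "represents (rep_measure f) f"
  shows "ip n (ap n (ent (accretive_fun f A)) x) x = (\<integral>s. ip n (ap n (ent (H s)) x) x \<partial>rep_measure f)"
proof -
  have dim: "dim_row A = n" using A by simp
  have F: "accretive_fun f A $$ (i, j) = (\<integral>s. H s $$ (i, j) \<partial>rep_measure f)" if "i < n" "j < n" for i j
    using that by (simp add: accretive_fun_def dim H_def B_def invA_def)
  have int: "integrable (rep_measure f) (\<lambda>s. H s $$ (i, j))" if "i < n" "j < n" for i j
    using that by (intro represents_integrable[OF \<nu>] continuous_on_H)
  have "(\<integral>s. ip n (ap n (ent (H s)) x) x \<partial>rep_measure f)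
    = (\<Sum>i<n. \<Sum>k<n. \<integral>s. H s $$ (i, k) * x k * cnj (x i) \<partial>rep_measure f)"
    unfolding ip_def ap_def sum_distrib_right using int
    by (subst Bochner_Integration.integral_sum; (intro Bochner_Integration.integrable_sum sum.cong refl Bochner_Integration.integral_sum)?) auto
  also have "\<dots> = ip n (ap n (ent (accretive_fun f A)) x) x"
    unfolding ip_def ap_def sum_distrib_right using F int by (intro sum.cong refl) simp
  finally show ?thesis ..
qed

lemma numerical_radius_upper: "numerical_radius A \<le> (1 / cos \<alpha>) * r"
  and numerical_radius_lower: "r \<le> numerical_radius A"
proof -
  have ub: "cmod w \<le> (1 / cos \<alpha>) * r" if "w \<in> numerical_range A" for w
  proof -
    obtain x where x: "ip n x x = 1" "w = \<Phi> x x" using \<open>w \<in> numerical_range A\<close> unfolding numerical_range_eq[OF A] by blast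
    have "cmod w \<le> (1 / cos \<alpha>) * Re w"
      unfolding x(2) one_plus_tan_square(2)[symmetric]
      by (rule complex_norm_le_sector[OF tan_nonneg form_sector form_nonneg])
    also have "\<dots> \<le> (1 / cos \<alpha>) * r"
      using cos_pos unit_le_r[OF x(1)] unfolding x(2) by (intro mult_left_mono) auto
    finally show ?thesis .
  qed
  obtain x0 where x0: "ip n x0 x0 = 1" using ex_unit[OF n] by blast
  show "numerical_radius A \<le> (1 / cos \<alpha>) * r"
    unfolding numerical_radius_def using in_range[OF x0] ub by (intro cSup_least) auto
  have "bdd_above (cmod ` numerical_range A)" using ub by (intro bdd_aboveI) auto
  then have le: "cmod (\<Phi> x x) \<le> numerical_radius A" if "ip n x x = 1" for x
    unfolding numerical_radius_def using in_range[OF that] by (intro cSup_upper) auto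
  have "Re (\<Phi> x x) \<le> numerical_radius A" if "ip n x x = 1" for x
    using le[OF that] complex_Re_le_cmod[of "\<Phi> x x"] by linarith
  then show "r \<le> numerical_radius A"
    unfolding r_def using x0 by (intro cSup_least) auto
qed

text \<open>The sector is a convex cone, so the integrated form stays in it: its modulus is at most
  sec \<alpha> times its real part, and the real part brings the other two factors. For the lower
  bound one eigenvector serves every \<open>s\<close>, so the pointwise estimates can be
  integrated.\<close>

lemma numerical_radius_accretive_fun:
  assumes \<nu>: "represents (rep_measure f) f"
  shows "f r \<le> numerical_radius (accretive_fun f A)"
    and "numerical_radius (accretive_fun f A) \<le> (1 / cos \<alpha>) ^ 3 * f r"
proof -
  let ?\<nu> = "rep_measure f"
  define F where "F = accretive_fun f A"
  define \<psi> where "\<psi> x s = ip n (ap n (ent (H s)) x) x" for x s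
  have Fc: "F \<in> carrier_mat n n" using A by (simp add: F_def accretive_fun_def)
  note space = represents_space[OF \<nu>]
  have int: "integrable ?\<nu> (\<psi> x)" for x
    unfolding \<psi>_def by (intro represents_integrable[OF \<nu>] continuous_on_H_form)
  have intk: "integrable ?\<nu> (\<lambda>s. kern s r)"
    by (intro represents_integrable[OF \<nu>] continuous_on_kern r_pos)
  have form: "ip n (ap n (ent F) x) x = integral\<^sup>L ?\<nu> (\<psi> x)" for x
    unfolding F_def \<psi>_def by (rule accretive_fun_form[OF \<nu>])
  have ReI: "Re (integral\<^sup>L ?\<nu> (\<psi> x)) = (\<integral>s. Re (\<psi> x s) \<partial>?\<nu>)"
    and ImI: "Im (integral\<^sup>L ?\<nu> (\<psi> x)) = (\<integral>s. Im (\<psi> x s) \<partial>?\<nu>)"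
    and intRe: "integrable ?\<nu> (\<lambda>s. Re (\<psi> x s))" and intIm: "integrable ?\<nu> (\<lambda>s. Im (\<psi> x s))" for x
    using int[of x] by simp_all
  have Re_nonneg: "0 \<le> Re (integral\<^sup>L ?\<nu> (\<psi> x))" for x
    unfolding ReI using H_sector(2) by (intro Bochner_Integration.integral_nonneg) (auto simp: space \<psi>_def)
  have Im_le: "\<bar>Im (integral\<^sup>L ?\<nu> (\<psi> x))\<bar> \<le> tan \<alpha> * Re (integral\<^sup>L ?\<nu> (\<psi> x))" for x
  proof -
    have "\<bar>Im (integral\<^sup>L ?\<nu> (\<psi> x))\<bar> \<le> (\<integral>s. \<bar>Im (\<psi> x s)\<bar> \<partial>?\<nu>)"
      unfolding ImI by (rule integral_abs_bound)
    also have "\<dots> \<le> (\<integral>s. tan \<alpha> * Re (\<psi> x s) \<partial>?\<nu>)"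
      using H_sector(1) intRe intIm
      by (intro integral_mono integrable_abs integrable_mult_right) (auto simp: space \<psi>_def)
    also have "\<dots> = tan \<alpha> * Re (integral\<^sup>L ?\<nu> (\<psi> x))" unfolding ReI by simp
    finally show ?thesis .
  qed
  have Re_upper: "Re (integral\<^sup>L ?\<nu> (\<psi> x)) \<le> (1 / cos \<alpha>)\<^sup>2 * f r" if "ip n x x = 1" for x
  proof -
    have "Re (integral\<^sup>L ?\<nu> (\<psi> x)) \<le> (\<integral>s. (1 + (tan \<alpha>)\<^sup>2) * kern s r \<partial>?\<nu>)"
      unfolding ReI using H_upper that intRe intk
      by (intro integral_mono integrable_mult_right) (auto simp: space \<psi>_def)
    then show ?thesis
      unfolding one_plus_tan_square(1) represents_eq[OF \<nu> r_pos] by simp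
  qed
  have ub: "cmod w \<le> (1 / cos \<alpha>) ^ 3 * f r" if "w \<in> numerical_range F" for w
  proof -
    obtain x where x: "ip n x x = 1" "w = integral\<^sup>L ?\<nu> (\<psi> x)"
      using \<open>w \<in> numerical_range F\<close> unfolding numerical_range_eq[OF Fc] form by blast
    have "cmod w \<le> (1 / cos \<alpha>) * Re w"
      unfolding x(2) one_plus_tan_square(2)[symmetric]
      by (rule complex_norm_le_sector[OF tan_nonneg Im_le Re_nonneg])
    also have "\<dots> \<le> (1 / cos \<alpha>) * ((1 / cos \<alpha>)\<^sup>2 * f r)"
      using cos_pos Re_upper[OF x(1)] unfolding x(2) by (intro mult_left_mono) auto
    finally show ?thesis by (simp add: power3_eq_cube power2_eq_square)
  qed
  have mem: "integral\<^sup>L ?\<nu> (\<psi> x) \<in> numerical_range F" if "ip n x x = 1" for x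
    unfolding numerical_range_eq[OF Fc] form using that by blast
  obtain x where x: "ip n x x = 1" "\<And>y. \<Phi> x y + cnj (\<Phi> y x) = 2 * of_real r * ip n x y"
    using ex_top_eigenvector by blast
  show "numerical_radius (accretive_fun f A) \<le> (1 / cos \<alpha>) ^ 3 * f r"
    unfolding numerical_radius_def F_def[symmetric] using mem[OF x(1)] ub by (intro cSup_least) auto
  have "f r \<le> Re (integral\<^sup>L ?\<nu> (\<psi> x))"
    unfolding ReI represents_eq[OF \<nu> r_pos] using H_lower[OF _ _ x] intRe intk
    by (intro integral_mono) (auto simp: space \<psi>_def)
  also have "\<dots> \<le> cmod (integral\<^sup>L ?\<nu> (\<psi> x))" by (rule complex_Re_le_cmod)
  also have "\<dots> \<le> numerical_radius F"
    unfolding numerical_radius_def using mem[OF x(1)] ub by (intro cSup_upper bdd_aboveI) auto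
  finally show "f r \<le> numerical_radius (accretive_fun f A)" by (simp add: F_def)
qed

end

theorem theorem3p4:
  fixes n :: nat and \<alpha> :: real and A :: "complex mat" and f :: "real \<Rightarrow> real"
  assumes "0 < n"
    and "0 \<le> \<alpha>" and "\<alpha> < pi / 2"
    and "A \<in> carrier_mat n n"
    and "sectorial \<alpha> A"
    and "accretive A"
    and "\<And>x. 0 < x \<Longrightarrow> 0 < f x"
    and "operator_monotone f"
    and "f 1 = 1"
  shows "cos \<alpha> * f (numerical_radius A) \<le> numerical_radius (accretive_fun f A)
       \<and> numerical_radius (accretive_fun f A) \<le> (1 / cos \<alpha>) ^ 3 * f (numerical_radius A)"
proof -
  interpret f: normalized_operator_monotone f by standard fact+
  interpret accretive_sectorial n \<alpha> A by standard fact+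
  note \<nu> = f.represents_rep_measure
  define w where "w = numerical_radius A"
  have rw: "r \<le> w" unfolding w_def by (rule numerical_radius_lower)
  have w0: "0 < w" using r_pos rw by linarith
  have c1: "1 \<le> 1 / cos \<alpha>" using cos_pos by (simp add: field_simps)
  \<comment> \<open>The radius \<open>w\<close> exceeds \<open>r\<close> by at most the factor
    \<open>1 / cos \<alpha>\<close>, which the scaling inequality pulls out of \<open>f\<close>. The
    upper bound below costs nothing more, as \<open>r \<le> w\<close> and \<open>f\<close> is
    monotone.\<close>
  have "f w \<le> f ((1 / cos \<alpha>) * r)"
    unfolding w_def using numerical_radius_upper w0
    by (intro represents_mono[OF \<nu>]) (auto simp: w_def)
  also have "\<dots> \<le> (1 / cos \<alpha>) * f r" by (rule represents_scale_le[OF \<nu> r_pos c1])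
  finally have "cos \<alpha> * f w \<le> f r" using cos_pos by (simp add: field_simps)
  then have "cos \<alpha> * f w \<le> numerical_radius (accretive_fun f A)"
    using numerical_radius_accretive_fun(1)[OF \<nu>] by linarith
  moreover have "(1 / cos \<alpha>) ^ 3 * f r \<le> (1 / cos \<alpha>) ^ 3 * f w"
    using cos_pos represents_mono[OF \<nu> r_pos rw] by (intro mult_left_mono) auto
  then have "numerical_radius (accretive_fun f A) \<le> (1 / cos \<alpha>) ^ 3 * f w"
    using numerical_radius_accretive_fun(2)[OF \<nu>] by linarith
  ultimately show ?thesis by (simp add: w_def)
qed

end
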